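(* Let $G=(V,E)$ be a finite connected Eulerian directed multigraph and let $\alpha$ be a probability distribution on $V$ with $\alpha_i>0$ for all $i\in V$. For an initial sandpile $s_0:V\to\mathbb{Z}$ let $(s_k)_{k\ge0}$ be the closed chain started at $s_0$ and driven by the i.i.d. sequence $i_1,i_2,\ldots$ with law $\alpha$, and let $\tau=\min\{k\ge0: s_k\text{ is not stabilizable}\}$. Then for any $n\in\mathbb{N}$ and any $z\in V$, as $|s_0|\to-\infty$, $$\mathbb{P}_{s_0}(|s_\tau|=n)\;\to\;\frac1\kappa\sum_{\rho\in\mathrm{Rec}(z)}\mathbf{1}\{|\rho|=n\}.$$
   Context: Graph and Laplacian. $G=(V,E)$ is a finite directed graph, multiple edges permitted, connected and Eulerian: each vertex $i$ has the same number $\deg(i)$ of incoming edges as outgoing edges. For $u:V\to\mathbb{Z}$, $\Delta u(i)=-\deg(i)u(i)+\sum_e u(e^-)$, the sum being over edges $e$ coming into $i$, with $e^-$ the other endpoint (tail) of $e$. $\delta_i(j)=\mathbf{1}\{i=j\}$. $\mathbb{N}=\{0,1,2,\ldots\}$. Sandpiles. A sandpile is a function $s:V\to\mathbb{Z}$ (negative values allowed); $|s|=\sum_{i\in V}s(i)$ (the sum includes every vertex). Vertex $i$ is unstable if $s(i)\ge\deg(i)$; toppling an unstable vertex $i$ replaces $s$ by $s+\Delta\delta_i$. $s$ is stabilizable if some finite (possibly empty) sequence of topplings of unstable vertices leads to a sandpile $\mathcal{S}(s)\le\deg-1$ (coordinatewise); $\mathcal{S}(s)$ does not depend on the sequence chosen.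 Closed chain. For $i\in V$, $a_i s=\mathcal{S}(s+\delta_i)$ if $s+\delta_i$ is stabilizable, and $a_i s=s+\delta_i$ otherwise. Let $i_1,i_2,\ldots$ be independent random vertices with law $\alpha$. The closed chain started from a sandpile $s_0$ is $s_k=a_{i_k}s_{k-1}$ for $k\ge1$. $\mathbb{P}_{s_0}$ is the law of the process with initial state $s_0$. Recurrent sandpiles. For a vertex $z$ (the sink), $\mathcal{S}_z$ denotes stabilization in which $z$ is forbidden to topple: unstable vertices other than $z$ are toppled until no vertex of $V-\{z\}$ is unstable (this always terminates), and chips entering $z$ disappear. A sandpile $\rho$ is $z$-recurrent if $\rho(z)=\deg(z)$, $\rho(i)\le\deg(i)-1$ for all $i\ne z$, and every vertex of $V-\{z\}$ topples exactly once during the stabilization of $\rho+\Delta\delta_z$ with respect to $\mathcal{S}_z$. $\mathrm{Rec}(z)$ is the set of $z$-recurrent sandpiles; its cardinality $\kappa$ does not depend on $z$. Limit. "$F(s_0)\to L$ as $|s_0|\to-\infty$" means: for every $\epsilon>0$ there is $K<0$ such that $|F(s_0)-L|\le\epsilon$ for every $s_0:V\to\mathbb{Z}$ with $|s_0|<K$. Known fact (Perrot and Pham), which may be used: for a connected Eulerian graph and each $n\in\mathbb{N}$, the number of $\rho\in\mathrm{Rec}(z)$ with $|\rho|=n$ does not depend on $z$. *)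

theory Defs
  imports "HOL-Probability.Probability" "Graph_Theory.Digraph_Component"
begin

definition eulerian :: "('a, 'b) pre_digraph \<Rightarrow> bool" where
  "eulerian G \<longleftrightarrow> (\<forall>i \<in> verts G. in_degree G i = out_degree G i)"

text \<open>
  Only used for Eulerian graphs, where in- and out-degree agree. Loops are allowed; a loop counts
  once in each of the two degrees, so it cancels in the Laplacian.
\<close>

definition deg :: "('a, 'b) pre_digraph \<Rightarrow> 'a \<Rightarrow> int" where
  "deg G i = int (out_degree G i)"

definition laplacian :: "('a, 'b) pre_digraph \<Rightarrow> ('a \<Rightarrow> int) \<Rightarrow> 'a \<Rightarrow> int" where
  "laplacian G u i = - deg G i * u i + (\<Sum>e \<in> in_arcs G i. u (tail G e))"

definition \<delta> :: "'a \<Rightarrow> 'a \<Rightarrow> int" where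
  "\<delta> i j = (if i = j then 1 else 0)"

text \<open>
  A function from the vertex set to the integers is represented by its extension by \<open>0\<close> to the
  whole vertex type. This makes the representation unique, so that sets of sandpiles have the
  right cardinality. The Laplacian of any function vanishes off the vertex set of a well-formed
  digraph, so toppling preserves this set.
\<close>

definition sandpiles :: "('a, 'b) pre_digraph \<Rightarrow> ('a \<Rightarrow> int) set" where
  "sandpiles G = {s. \<forall>i. i \<notin> verts G \<longrightarrow> s i = 0}"

definition mass :: "('a, 'b) pre_digraph \<Rightarrow> ('a \<Rightarrow> int) \<Rightarrow> int" where
  "mass G s = (\<Sum>i \<in> verts G. s i)"

definition unstable :: "('a, 'b) pre_digraph \<Rightarrow> ('a \<Rightarrow> int) \<Rightarrow> 'a \<Rightarrow> bool" where
  "unstable G s i \<longleftrightarrow> i \<in> verts G \<and> s i \<ge> deg G i"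

definition topple :: "('a, 'b) pre_digraph \<Rightarrow> ('a \<Rightarrow> int) \<Rightarrow> 'a \<Rightarrow> 'a \<Rightarrow> int" where
  "topple G s i = (\<lambda>j. s j + laplacian G (\<delta> i) j)"

inductive topplings ::
  "('a, 'b) pre_digraph \<Rightarrow> ('a \<Rightarrow> int) \<Rightarrow> 'a list \<Rightarrow> ('a \<Rightarrow> int) \<Rightarrow> bool" for G where
  Nil: "topplings G s [] s"
| Cons: "unstable G s i \<Longrightarrow> topplings G (topple G s i) is t \<Longrightarrow> topplings G s (i # is) t"

definition stabilizes_to ::
  "('a, 'b) pre_digraph \<Rightarrow> ('a \<Rightarrow> int) \<Rightarrow> ('a \<Rightarrow> int) \<Rightarrow> bool" where
  "stabilizes_to G s t \<longleftrightarrow>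
     (\<exists>is. topplings G s is t) \<and> (\<forall>i \<in> verts G. t i \<le> deg G i - 1)"

definition stabilizable :: "('a, 'b) pre_digraph \<Rightarrow> ('a \<Rightarrow> int) \<Rightarrow> bool" where
  "stabilizable G s \<longleftrightarrow> (\<exists>t. stabilizes_to G s t)"

text \<open>
  The final sandpile is unique by the abelian property, so the description is proper whenever
  the sandpile is stabilizable; it is only used in that case.
\<close>

definition stabilization :: "('a, 'b) pre_digraph \<Rightarrow> ('a \<Rightarrow> int) \<Rightarrow> 'a \<Rightarrow> int" where
  "stabilization G s = (THE t. stabilizes_to G s t)"

definition add_chip :: "('a, 'b) pre_digraph \<Rightarrow> 'a \<Rightarrow> ('a \<Rightarrow> int) \<Rightarrow> 'a \<Rightarrow> int" where
  "add_chip G i s =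
     (let s' = (\<lambda>j. s j + \<delta> i j)
      in if stabilizable G s' then stabilization G s' else s')"

text \<open>The driving sequence is indexed from \<open>1\<close>; its value at \<open>0\<close> is not used.\<close>

primrec closed_chain ::
  "('a, 'b) pre_digraph \<Rightarrow> ('a \<Rightarrow> int) \<Rightarrow> (nat \<Rightarrow> 'a) \<Rightarrow> nat \<Rightarrow> 'a \<Rightarrow> int" where
  "closed_chain G s\<^sub>0 is 0 = s\<^sub>0"
| "closed_chain G s\<^sub>0 is (Suc k) = add_chip G (is (Suc k)) (closed_chain G s\<^sub>0 is k)"

text \<open>
  For a driving sequence of vertices the set of which we take the minimum is never empty: the
  \<open>k\<close>-th state has mass \<open>mass G s\<^sub>0 + k\<close>, while the mass of a stabilizable sandpile is at
  most the sum of all \<open>deg G i - 1\<close>.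
\<close>

definition threshold_time ::
  "('a, 'b) pre_digraph \<Rightarrow> ('a \<Rightarrow> int) \<Rightarrow> (nat \<Rightarrow> 'a) \<Rightarrow> nat" where
  "threshold_time G s\<^sub>0 is = (LEAST k. \<not> stabilizable G (closed_chain G s\<^sub>0 is k))"

definition threshold_state ::
  "('a, 'b) pre_digraph \<Rightarrow> ('a \<Rightarrow> int) \<Rightarrow> (nat \<Rightarrow> 'a) \<Rightarrow> 'a \<Rightarrow> int" where
  "threshold_state G s\<^sub>0 is = closed_chain G s\<^sub>0 is (threshold_time G s\<^sub>0 is)"

text \<open>Toppling with sink \<open>z\<close>: chips entering \<open>z\<close> disappear, and \<open>z\<close> itself may not topple.\<close>

definition sink_topple ::
  "('a, 'b) pre_digraph \<Rightarrow> 'a \<Rightarrow> ('a \<Rightarrow> int) \<Rightarrow> 'a \<Rightarrow> 'a \<Rightarrow> int" where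
  "sink_topple G z s i = (topple G s i)(z := s z)"

inductive sink_topplings ::
  "('a, 'b) pre_digraph \<Rightarrow> 'a \<Rightarrow> ('a \<Rightarrow> int) \<Rightarrow> 'a list \<Rightarrow> ('a \<Rightarrow> int) \<Rightarrow> bool" for G z where
  Nil: "sink_topplings G z s [] s"
| Cons: "unstable G s i \<Longrightarrow> i \<noteq> z \<Longrightarrow> sink_topplings G z (sink_topple G z s i) is t \<Longrightarrow>
     sink_topplings G z s (i # is) t"

text \<open>
  By the abelian property the number of times a vertex topples is the same in every
  stabilizing sequence, so it does not matter which sequence is taken here.
\<close>

definition each_topples_once ::
  "('a, 'b) pre_digraph \<Rightarrow> 'a \<Rightarrow> ('a \<Rightarrow> int) \<Rightarrow> bool" where
  "each_topples_once G z s \<longleftrightarrow>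
     (\<exists>is t. sink_topplings G z s is t \<and>
        (\<forall>i \<in> verts G - {z}. \<not> unstable G t i) \<and>
        (\<forall>i \<in> verts G - {z}. count_list is i = 1))"

definition Rec :: "('a, 'b) pre_digraph \<Rightarrow> 'a \<Rightarrow> ('a \<Rightarrow> int) set" where
  "Rec G z =
     {\<rho> \<in> sandpiles G. \<rho> z = deg G z \<and>
        (\<forall>i \<in> verts G - {z}. \<rho> i \<le> deg G i - 1) \<and>
        each_topples_once G z (\<lambda>j. \<rho> j + laplacian G (\<delta> z) j)}"

end

theory Submission
  imports Defs
begin

text \<open>
  The idea is to follow the closed chain only up to firings. By the least action principle
  (\<open>least_action\<close>, \<open>stabilizable_iff\<close>) a sandpile is stabilizable as soon as \<^emph>\<open>some\<close> integer
  combination of firings, legal or not, makes it stable. So stabilizability depends only on the class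
  of a sandpile modulo the image of the Laplacian, and in this class the closed chain is the random
  walk that adds chips and never topples.
  
  Fix the sink \<open>z\<close>. Every sandpile \<open>s\<close> agrees, up to firings and up to its value at \<open>z\<close>,
  with exactly one \<open>z\<close>-recurrent sandpile \<open>rec_rep z s\<close>, by Dhar's burning criterion and a maximum
  principle (\<open>Rec_equiv_off_unique\<close>, \<open>exists_equiv_Rec\<close>). As a recurrent sandpile sits exactly at the
  threshold of stability at \<open>z\<close>, mass alone decides: \<open>s\<close> is stabilizable if and only if
  \<open>mass G s < mass G (rec_rep z s)\<close> (\<open>stabilizable_iff_mass\<close>). Every step adds one chip and loss
  of stabilizability is permanent. Hence, with \<open>k = n - mass G s\<^sub>0\<close>, the threshold mass is at most \<open>n\<close> if
  and only if the recurrent representative after \<open>k\<close> steps has mass at most \<open>n\<close>.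
  
  The representatives perform a random walk on the finite set \<open>Rec G z\<close> whose steps are bijections.
  Every state can be reached from every other one, and adding a chip at \<open>z\<close> is an idle step, so the law of
  the walk converges to the uniform distribution, uniformly in the starting point
  (\<open>averaging_pow_tendsto_mean\<close>). As \<open>mass G s\<^sub>0\<close> tends to minus infinity, \<open>k\<close> tends to infinity, and
  the distribution function of the threshold mass at \<open>n\<close> tends to that of the mass of a uniform element of
  \<open>Rec G z\<close>; taking differences in \<open>n\<close> gives the point probabilities. The argument works for every
  sink separately, so the independence of the mass distribution on \<open>Rec G z\<close> from \<open>z\<close> comes out as a
  by-product.
\<close>

section \<open>The Laplacian of a connected Eulerian digraph\<close>

locale eulerian_digraph = fin_digraph G for G :: "('a, 'b) pre_digraph" +
  assumes connected: "Digraph_Component.connected G"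
    and eulerian: "eulerian G"
begin

lemma laplacian_add: "laplacian G (\<lambda>j. u j + w j) i = laplacian G u i + laplacian G w i"
  by (simp add: laplacian_def sum.distrib algebra_simps)

lemma laplacian_scale: "laplacian G (\<lambda>j. c * u j) i = c * laplacian G u i"
  by (simp add: laplacian_def sum_distrib_left algebra_simps)

lemma laplacian_uminus: "laplacian G (\<lambda>j. - u j) i = - laplacian G u i"
  using laplacian_scale[of "-1" u i] by simp

lemma laplacian_diff: "laplacian G (\<lambda>j. u j - w j) i = laplacian G u i - laplacian G w i"
  using laplacian_add[of u "\<lambda>j. - w j" i] by (simp add: laplacian_uminus)

lemma laplacian_mono:
  assumes "\<And>j. j \<in> verts G \<Longrightarrow> u j \<le> w j" and "u i = w i"
  shows "laplacian G u i \<le> laplacian G w i"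
  unfolding laplacian_def using assms
  by (auto intro!: sum_mono simp: in_arcs_def)

lemma laplacian_cong:
  assumes "\<And>j. j \<in> verts G \<Longrightarrow> u j = w j" and "i \<in> verts G"
  shows "laplacian G u i = laplacian G w i"
  using assms by (intro antisym laplacian_mono) auto

lemma laplacian_outside: "i \<notin> verts G \<Longrightarrow> laplacian G u i = 0"
proof -
  assume i: "i \<notin> verts G"
  have "in_arcs G i = {}" "out_arcs G i = {}"
    using i wellformed by (auto simp: in_arcs_def out_arcs_def)
  then show ?thesis by (simp add: laplacian_def deg_def out_degree_def)
qed

lemma laplacian_const: "laplacian G (\<lambda>_. c) i = 0"
proof (cases "i \<in> verts G")
  case True
  then have "deg G i = int (card (in_arcs G i))"
    using eulerian by (simp add: eulerian_def deg_def in_degree_def)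
  then show ?thesis by (simp add: laplacian_def)
qed (rule laplacian_outside)

text \<open>
  Firing a vertex preserves the total number of chips: summed over all heads, the chips
  received from \<open>i\<close> number its out-degree, which is what \<open>i\<close> gives away.
\<close>

lemma sum_laplacian: "(\<Sum>i\<in>verts G. laplacian G u i) = 0"
proof -
  have "(\<Sum>i\<in>verts G. \<Sum>e\<in>in_arcs G i. u (tail G e)) = (\<Sum>e\<in>arcs G. u (tail G e))"
    unfolding in_arcs_def by (rule sum.group) auto
  also have "\<dots> = (\<Sum>i\<in>verts G. \<Sum>e\<in>out_arcs G i. u (tail G e))"
    unfolding out_arcs_def by (rule sum.group[symmetric]) auto
  also have "\<dots> = (\<Sum>i\<in>verts G. deg G i * u i)"
    by (intro sum.cong refl) (simp add: deg_def out_degree_def)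
  finally show ?thesis
    by (simp add: laplacian_def sum_subtractf)
qed

lemma mass_add: "mass G (\<lambda>j. s j + t j) = mass G s + mass G t"
  by (simp add: mass_def sum.distrib)

lemma mass_add_laplacian: "mass G (\<lambda>j. s j + laplacian G u j) = mass G s"
  using sum_laplacian[of u] by (simp add: mass_add) (simp add: mass_def)

lemma mass_delta: "i \<in> verts G \<Longrightarrow> mass G (\<lambda>j. s j + c * \<delta> i j) = mass G s + c"
  by (simp add: mass_add) (simp add: mass_def \<delta>_def if_distrib cong: if_cong)

text \<open>
  Connectedness is that of the underlying undirected graph. In an Eulerian digraph as many arcs
  enter a vertex set as leave it, so a cut that no arc leaves is not crossed by any arc. The
  balance is expressed here by the vanishing total of the Laplacian of the indicator of \<open>A\<close>.
\<close>

lemma exists_arc_leaving: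
  assumes A: "A \<subseteq> verts G" "z \<in> A" "A \<noteq> verts G"
  shows "\<exists>e\<in>arcs G. tail G e \<in> A \<and> head G e \<notin> A"
proof (rule ccontr)
  assume no: "\<not> ?thesis"
  define f where "f j = (of_bool (j \<in> A) :: int)" for j
  have f2: "laplacian G f i \<le> 0" if "i \<in> A" for i
    using laplacian_mono[of f "\<lambda>_. 1" i] that by (simp add: f_def laplacian_const)
  have eq: "laplacian G f i = 0" if "i \<in> verts G - A" for i
    using that no unfolding laplacian_def f_def by (auto intro!: sum.neutral)
  have "(\<Sum>i\<in>A. laplacian G f i) = 0"
    using sum_laplacian[of f] sum.subset_diff[OF A(1) finite_verts, of "laplacian G f"] eq
    by simp
  then have eqA: "laplacian G f i = 0" if "i \<in> A" for i
    using sum_nonneg_eq_0_iff[of A "\<lambda>i. - laplacian G f i"] f2 that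
      finite_subset[OF A(1) finite_verts] by (simp add: sum_negf)
  have no': "tail G e \<in> A" if e: "e \<in> arcs G" "head G e \<in> A" for e
  proof (rule ccontr)
    assume t: "tail G e \<notin> A"
    let ?i = "head G e"
    have "laplacian G (\<lambda>_. 1) ?i - laplacian G f ?i = (\<Sum>e'\<in>in_arcs G ?i. 1 - f (tail G e'))"
      using e by (simp add: laplacian_def f_def sum_subtractf)
    then have "(\<Sum>e'\<in>in_arcs G ?i. 1 - f (tail G e')) = 0"
      using eqA[OF e(2)] by (simp add: laplacian_const)
    then have "1 - f (tail G e) = 0"
      using e by (subst (asm) sum_nonneg_eq_0_iff) (auto simp: f_def)
    then show False using t by (simp add: f_def)
  qed
  obtain x where x: "x \<in> verts G" "x \<notin> A" using A by auto
  have "(z, x) \<in> rtrancl_on (verts G) ((arcs_ends G)\<^sup>s)"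
    using connected x A by (auto simp: connected_conv)
  then have "x \<in> A"
  proof (induction rule: rtrancl_on_induct)
    case (step y w)
    then show ?case using no no' by (auto simp: symcl_def arcs_ends_def arc_to_ends_def)
  qed (use A in simp)
  then show False using x by simp
qed

text \<open>
  Such a function plays the part of the inverse of the Laplacian with sink \<open>z\<close>: adding or
  subtracting a large multiple of \<open>laplacian G v\<close> raises or lowers all heights off \<open>z\<close>. So up
  to firings and the height of \<open>z\<close> every sandpile can be made stable, and any two of them can
  be joined by adding chips. It is built by growing a set \<open>A\<close> from \<open>{z}\<close> along arcs, each new
  vertex \<open>x\<close> receiving a value negligible against the values before it.
\<close>

lemma exists_subharmonic_off:
  assumes "z \<in> verts G"
  shows "\<exists>v. \<forall>i\<in>verts G - {z}. 1 \<le> laplacian G v i"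
proof -
  define P where "P A \<longleftrightarrow> (\<exists>v. (\<forall>i\<in>A. 1 \<le> v i) \<and> (\<forall>i\<in>verts G - A. v i = 0) \<and>
    (\<forall>i\<in>A - {z}. 1 \<le> laplacian G v i))" for A :: "'a set"
  have step: "\<exists>x\<in>verts G - A. P (insert x A)"
    if A: "A \<subseteq> verts G" "z \<in> A" "A \<noteq> verts G" "P A" for A
  proof -
    obtain e where e: "e \<in> arcs G" "tail G e \<in> A" "head G e \<notin> A"
      using exists_arc_leaving[OF A(1-3)] by blast
    define x where "x = head G e"
    have x: "x \<in> verts G - A" using e by (simp add: x_def)
    obtain v where v: "\<And>i. i \<in> A \<Longrightarrow> 1 \<le> v i" "\<And>i. i \<in> verts G - A \<Longrightarrow> v i = 0"
      "\<And>i. i \<in> A - {z} \<Longrightarrow> 1 \<le> laplacian G v i"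
      using A(4) unfolding P_def by blast
    have v_nonneg: "0 \<le> v i" if "i \<in> verts G" for i
      using v(1,2)[of i] that by force
    \<comment> \<open>This factor makes the income of \<open>x\<close> from \<open>A\<close>, at least \<open>M\<close>,
      outweigh what \<open>x\<close> loses by its own value 1, at most \<open>deg G x\<close>.\<close>
    define M where "M = deg G x + 1"
    have M: "1 \<le> M" by (simp add: M_def deg_def)
    define w where "w j = M * v j + \<delta> x j" for j
    have lw: "laplacian G w i = M * laplacian G v i + laplacian G (\<delta> x) i" for i
      unfolding w_def by (simp add: laplacian_add laplacian_scale)
    have "1 \<le> (\<Sum>e'\<in>{e}. v (tail G e'))" using v(1) e by simp
    also have "\<dots> \<le> (\<Sum>e'\<in>in_arcs G x. v (tail G e'))"
      using e by (intro sum_mono2) (auto simp: x_def intro!: v_nonneg)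
    also have "\<dots> = laplacian G v x"
      using v(2) x by (simp add: laplacian_def)
    finally have vx: "1 \<le> laplacian G v x" .
    have dx: "- deg G x \<le> laplacian G (\<delta> x) x"
      by (auto simp: laplacian_def \<delta>_def intro!: sum_nonneg)
    have "M * 1 \<le> M * laplacian G v x" using vx M by (intro mult_left_mono) auto
    then have "1 \<le> laplacian G w x" using dx unfolding lw by (simp add: M_def)
    moreover have "1 \<le> laplacian G w i" if i: "i \<in> A - {z}" for i
    proof -
      have "0 \<le> laplacian G (\<delta> x) i"
        using i x by (auto simp: laplacian_def \<delta>_def intro!: sum_nonneg)
      moreover have "M * 1 \<le> M * laplacian G v i" using v(3)[OF i] M by (intro mult_left_mono) auto
      ultimately show ?thesis using M unfolding lw by linarith
    qed
    moreover have "1 \<le> w i" if "i \<in> insert x A" for i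
    proof (cases "i = x")
      case False
      then have "1 * 1 \<le> M * v i" using that v(1) M by (intro mult_mono) auto
      then show ?thesis by (simp add: w_def \<delta>_def)
    qed (use v(2) x in \<open>simp add: w_def \<delta>_def\<close>)
    moreover have "w i = 0" if "i \<in> verts G - insert x A" for i
      using that v(2) by (auto simp: w_def \<delta>_def)
    ultimately have "P (insert x A)"
      unfolding P_def by (intro exI[of _ w]) auto
    with x show ?thesis by blast
  qed
  have "P {z}"
    unfolding P_def by (rule exI[of _ "\<delta> z"]) (auto simp: \<delta>_def)
  have ex: "\<exists>A. z \<in> A \<and> A \<subseteq> verts G \<and> P A \<and> card A = Suc n" if "n < card (verts G)" for n
    using that
  proof (induction n)
    case 0
    then show ?case using \<open>P {z}\<close> assms by (intro exI[of _ "{z}"]) auto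
  next
    case (Suc n)
    then obtain A where A: "z \<in> A" "A \<subseteq> verts G" "P A" "card A = Suc n" by auto
    then have "A \<noteq> verts G" using Suc.prems by auto
    then obtain x where "x \<in> verts G - A" "P (insert x A)" using step A by blast
    then show ?case
      using A finite_subset[OF A(2)] by (intro exI[of _ "insert x A"]) auto
  qed
  have "0 < card (verts G)" using assms by (auto simp: card_gt_0_iff)
  then obtain A where "A \<subseteq> verts G" "P A" "card A = card (verts G)"
    using ex[of "card (verts G) - 1"] by auto
  then have "P (verts G)" using card_subset_eq[of "verts G" A] by simp
  then show ?thesis unfolding P_def by blast
qed

section \<open>The burning criterion\<close>

text \<open>
  Since firing all vertices changes nothing, subtracting the Laplacian of the
  indicator of \<open>B\<close> gives the heights after all vertices outside \<open>B\<close> have fired. This is Dhar's criterion: when \<open>z\<close> and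
  others have fired once, some vertex that has not yet fired is unstable.
\<close>

definition burnable :: "'a \<Rightarrow> ('a \<Rightarrow> int) \<Rightarrow> bool" where
  "burnable z \<rho> \<longleftrightarrow> (\<forall>B. B \<subseteq> verts G - {z} \<and> B \<noteq> {} \<longrightarrow>
     (\<exists>i\<in>B. deg G i \<le> \<rho> i - laplacian G (\<lambda>j. of_bool (j \<in> B)) i))"

lemma laplacian_indicator_compl:
  assumes "i \<in> verts G"
  shows "laplacian G (\<lambda>j. of_bool (j \<in> verts G - B)) i = - laplacian G (\<lambda>j. of_bool (j \<in> B)) i"
proof -
  have "laplacian G (\<lambda>j. of_bool (j \<in> verts G - B)) i
      = laplacian G (\<lambda>j. 1 - of_bool (j \<in> B)) i"
    by (rule laplacian_cong[OF _ assms]) auto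
  also have "\<dots> = - laplacian G (\<lambda>j. of_bool (j \<in> B)) i"
    by (simp add: laplacian_diff laplacian_const)
  finally show ?thesis .
qed

text \<open>
  The criterion speaks of indicator functions, but it extends to all functions: on the set where
  \<open>w\<close> attains its maximum \<open>m\<close>, the Laplacian of \<open>w\<close> is at most that of the indicator of this
  set, because \<open>w - (m - 1)\<close> is at most that indicator.
\<close>

lemma burnable_max_principle:
  assumes "burnable z \<rho>" "j \<in> verts G" "w z < w j"
  shows "\<exists>i\<in>verts G - {z}. deg G i \<le> \<rho> i - laplacian G w i"
proof -
  define m where "m = Max (w ` verts G)"
  have le: "w i \<le> m" if "i \<in> verts G" for i
    using that by (simp add: m_def)
  have "m \<in> w ` verts G" unfolding m_def using assms by (intro Max_in) auto
  define B where "B = {i\<in>verts G. w i = m}"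
  have "B \<noteq> {}" using \<open>m \<in> _\<close> by (auto simp: B_def)
  moreover have "B \<subseteq> verts G - {z}" using le[OF assms(2)] assms(3) by (auto simp: B_def)
  ultimately obtain i where i: "i \<in> B" "deg G i \<le> \<rho> i - laplacian G (\<lambda>j. of_bool (j \<in> B)) i"
    using assms(1) unfolding burnable_def by blast
  have "laplacian G w i - laplacian G (\<lambda>_. m - 1) i = laplacian G (\<lambda>j. w j - (m - 1)) i"
    by (simp only: laplacian_diff)
  also have "\<dots> \<le> laplacian G (\<lambda>j. of_bool (j \<in> B)) i"
  proof (rule laplacian_mono)
    fix j assume "j \<in> verts G"
    then show "w j - (m - 1) \<le> of_bool (j \<in> B)"
      using le[of j] by (auto simp: B_def)
  qed (use i in \<open>auto simp: B_def\<close>)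
  finally show ?thesis
    using i \<open>B \<subseteq> _\<close> by (intro bexI[of _ i]) (auto simp: laplacian_const)
qed

lemma count_list_distinct: "distinct xs \<Longrightarrow> count_list xs x = of_bool (x \<in> set xs)"
  by (induction xs) auto

lemma sink_topplings_append:
  assumes "sink_topplings G z s is t" "unstable G t i" "i \<noteq> z"
  shows "sink_topplings G z s (is @ [i]) (sink_topple G z t i)"
  using assms by (induction) (auto intro: sink_topplings.intros)

lemma sink_topplings_support:
  assumes "sink_topplings G z s is t"
  shows "set is \<subseteq> verts G - {z}"
  using assms by induction (auto simp: unstable_def)

lemma count_list_Cons_delta: "int (count_list (x # xs) j) = \<delta> x j + int (count_list xs j)"
  by (simp add: \<delta>_def)

lemma laplacian_count_Cons:
  "laplacian G (\<lambda>j. int (count_list (x # xs) j)) i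
     = laplacian G (\<delta> x) i + laplacian G (\<lambda>j. int (count_list xs j)) i"
  unfolding count_list_Cons_delta by (rule laplacian_add)

lemma sink_topplings_result:
  assumes "sink_topplings G z s is t" "i \<noteq> z"
  shows "t i = s i + laplacian G (\<lambda>j. int (count_list is j)) i"
  using assms
proof induction
  case (Nil s)
  then show ?case by (simp add: laplacian_const)
next
  case (Cons s x xs t)
  then show ?case by (simp only: laplacian_count_Cons) (simp add: sink_topple_def topple_def)
qed

lemma sink_topplings_split:
  assumes "sink_topplings G z s (xs @ i # ys) t"
  shows "deg G i \<le> s i + laplacian G (\<lambda>j. int (count_list xs j)) i"
  using assms
proof (induction xs arbitrary: s)
  case Nil
  then show ?case by (auto elim: sink_topplings.cases simp: unstable_def laplacian_const)
next
  case (Cons x xs)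
  then have "sink_topplings G z (sink_topple G z s x) (xs @ i # ys) t"
    by (auto elim: sink_topplings.cases)
  moreover from this have "i \<noteq> z" using sink_topplings_support by fastforce
  ultimately show ?case using Cons.IH[of "sink_topple G z s x"]
    by (simp only: laplacian_count_Cons) (simp add: sink_topple_def topple_def)
qed

text \<open>
  The first vertex of \<open>B\<close> to topple is unstable at a moment when only vertices outside \<open>B\<close>
  have toppled, each at most once; letting all of them topple only raises its height.
\<close>

lemma each_topples_once_imp_burnable:
  assumes once: "each_topples_once G z (\<lambda>j. \<rho> j + laplacian G (\<delta> z) j)"
  shows "burnable z \<rho>"
  unfolding burnable_def
proof (intro allI impI)
  fix B assume B: "B \<subseteq> verts G - {z} \<and> B \<noteq> {}"
  obtain "is" t where *: "sink_topplings G z (\<lambda>j. \<rho> j + laplacian G (\<delta> z) j) is t"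
    "\<forall>i\<in>verts G - {z}. count_list is i = 1"
    using once unfolding each_topples_once_def by blast
  have "\<exists>x\<in>set is. x \<in> B" using B *(2) by (metis all_not_in_conv count_notin in_mono zero_neq_one)
  then obtain xs i ys where split: "is = xs @ i # ys" "i \<in> B" "\<forall>x\<in>set xs. x \<notin> B"
    using split_list_first_prop[of "is" "\<lambda>x. x \<in> B"] by blast
  have iV: "i \<in> verts G" "i \<noteq> z" using B split by auto
  let ?T = "\<lambda>j. \<delta> z j + int (count_list xs j)"
  have "deg G i \<le> \<rho> i + laplacian G (\<delta> z) i + laplacian G (\<lambda>j. int (count_list xs j)) i"
    using sink_topplings_split *(1) split(1) by fastforce
  also have "\<dots> = \<rho> i + laplacian G ?T i" by (simp only: laplacian_add add.assoc)
  also have "laplacian G ?T i \<le> laplacian G (\<lambda>j. of_bool (j \<in> verts G - B)) i"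
  proof (rule laplacian_mono)
    fix j assume j: "j \<in> verts G"
    have "z \<notin> set xs" using sink_topplings_support[OF *(1)] split by auto
    moreover have "count_list xs j \<le> 1" if "j \<noteq> z"
    proof -
      have "count_list is j = 1" using *(2) j that by blast
      then show ?thesis using split(1) by simp
    qed
    moreover have "count_list xs j = 0" if "j \<in> B"
      using that split(3) by (meson count_notin)
    ultimately show "?T j \<le> of_bool (j \<in> verts G - B)"
      using j B by (auto simp: \<delta>_def)
  next
    show "?T i = of_bool (i \<in> verts G - B)"
      using split(2,3) iV by (auto simp: \<delta>_def)
  qed
  also have "\<dots> = - laplacian G (\<lambda>j. of_bool (j \<in> B)) i"
    by (rule laplacian_indicator_compl[OF iV(1)])
  finally show "\<exists>i\<in>B. deg G i \<le> \<rho> i - laplacian G (\<lambda>j. of_bool (j \<in> B)) i"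
    using split(2) by auto
qed

text \<open>
  Topple unstable vertices greedily, each at most once. The criterion, applied to the set of
  vertices that have not toppled, shows that one never gets stuck before all have toppled; then
  the heights off \<open>z\<close> are again those of \<open>\<rho>\<close>.
\<close>

lemma burnable_imp_each_topples_once:
  assumes burn: "burnable z \<rho>"
    and stable: "\<forall>i\<in>verts G - {z}. \<rho> i \<le> deg G i - 1"
  shows "each_topples_once G z (\<lambda>j. \<rho> j + laplacian G (\<delta> z) j)"
proof -
  let ?s = "\<lambda>j. \<rho> j + laplacian G (\<delta> z) j"
  have final: "t i = \<rho> i - laplacian G (\<lambda>j. of_bool (j \<in> verts G - {z} - set is)) i"
    if "distinct is" "sink_topplings G z ?s is t" "i \<in> verts G - {z}" for "is" t i
  proof -
    have "t i = \<rho> i + laplacian G (\<lambda>j. \<delta> z j + int (count_list is j)) i"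
      using sink_topplings_result[OF that(2), of i] that(3) by (simp add: laplacian_add)
    also have "laplacian G (\<lambda>j. \<delta> z j + int (count_list is j)) i
      = laplacian G (\<lambda>j. of_bool (j \<in> verts G - (verts G - {z} - set is))) i"
      using that sink_topplings_support[OF that(2)]
      by (intro laplacian_cong) (auto simp: \<delta>_def count_list_distinct)
    finally show ?thesis
      using laplacian_indicator_compl[of i "verts G - {z} - set is"] that(3) by simp
  qed
  have ex: "\<exists>is t. distinct is \<and> length is = n \<and> sink_topplings G z ?s is t"
    if "n \<le> card (verts G - {z})" for n
    using that
  proof (induction n)
    case 0
    then show ?case by (auto intro: sink_topplings.Nil)
  next
    case (Suc n)
    then obtain "is" t where *: "distinct is" "length is = n" "sink_topplings G z ?s is t" by auto
    let ?B = "verts G - {z} - set is"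
    have "card (set is) < card (verts G - {z})" using * Suc.prems by (simp add: distinct_card)
    then have "?B \<noteq> {}" by (metis Diff_eq_empty_iff List.finite_set card_mono leD)
    then obtain i where i: "i \<in> ?B" "deg G i \<le> \<rho> i - laplacian G (\<lambda>j. of_bool (j \<in> ?B)) i"
      using burn unfolding burnable_def by (metis Diff_subset)
    then have "unstable G t i" using final[OF *(1,3), of i] by (auto simp: unstable_def)
    then have "sink_topplings G z ?s (is @ [i]) (sink_topple G z t i)"
      using sink_topplings_append *(3) i by auto
    then show ?case using * i by (intro exI[of _ "is @ [i]"]) auto
  qed
  obtain "is" t where *: "distinct is" "length is = card (verts G - {z})"
    "sink_topplings G z ?s is t" using ex by blast
  then have set: "set is = verts G - {z}"
    using sink_topplings_support[OF *(3)]
    by (intro card_subset_eq) (auto simp: distinct_card)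
  have "\<not> unstable G t i" if "i \<in> verts G - {z}" for i
    using final[OF *(1,3) that] set bspec[OF stable that]
    by (simp add: unstable_def laplacian_const)
  moreover have "count_list is i = 1" if "i \<in> verts G - {z}" for i
    using * set that by (simp add: count_list_distinct)
  ultimately show ?thesis unfolding each_topples_once_def using *(3) by blast
qed


section \<open>Recurrent representatives\<close>

text \<open>
  Equality in the sandpile group with sink \<open>z\<close>: equality up to firings, where the height of
  \<open>z\<close> is ignored.
\<close>

definition equiv_off :: "'a \<Rightarrow> ('a \<Rightarrow> int) \<Rightarrow> ('a \<Rightarrow> int) \<Rightarrow> bool" where
  "equiv_off z s t \<longleftrightarrow> (\<exists>u. \<forall>i\<in>verts G - {z}. s i = t i + laplacian G u i)"

lemma equiv_off_sym: "equiv_off z s t \<Longrightarrow> equiv_off z t s"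
proof -
  assume "equiv_off z s t"
  then obtain u where "\<forall>i\<in>verts G - {z}. s i = t i + laplacian G u i"
    unfolding equiv_off_def by blast
  then show ?thesis unfolding equiv_off_def
    by (intro exI[of _ "\<lambda>j. - u j"]) (simp add: laplacian_uminus)
qed

lemma equiv_off_trans: "equiv_off z s t \<Longrightarrow> equiv_off z t r \<Longrightarrow> equiv_off z s r"
proof -
  assume "equiv_off z s t" "equiv_off z t r"
  then obtain u w where "\<forall>i\<in>verts G - {z}. s i = t i + laplacian G u i"
    "\<forall>i\<in>verts G - {z}. t i = r i + laplacian G w i"
    unfolding equiv_off_def by blast
  then show ?thesis unfolding equiv_off_def
    by (intro exI[of _ "\<lambda>j. w j + u j"]) (simp add: laplacian_add)
qed

lemma equiv_off_add: "equiv_off z s t \<Longrightarrow> equiv_off z (\<lambda>j. s j + r j) (\<lambda>j. t j + r j)"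
  unfolding equiv_off_def by (auto simp: algebra_simps)

lemma Rec_iff:
  "\<rho> \<in> Rec G z \<longleftrightarrow> \<rho> \<in> sandpiles G \<and> \<rho> z = deg G z \<and>
    (\<forall>i\<in>verts G - {z}. \<rho> i \<le> deg G i - 1) \<and> burnable z \<rho>"
  using each_topples_once_imp_burnable burnable_imp_each_topples_once
  unfolding Rec_def by blast

text \<open>
  If \<open>\<rho> = \<rho>' + laplacian G u\<close> off \<open>z\<close>, then neither \<open>u\<close> nor \<open>- u\<close> can exceed its value at
  \<open>z\<close>: otherwise the maximum principle gives an unstable vertex off \<open>z\<close> in \<open>\<rho>'\<close> or in
  \<open>\<rho>\<close>. So \<open>u\<close> is constant.
\<close>

lemma Rec_equiv_off_unique:
  assumes z: "z \<in> verts G" and "\<rho> \<in> Rec G z" "\<rho>' \<in> Rec G z" "equiv_off z \<rho> \<rho>'"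
  shows "\<rho> = \<rho>'"
proof -
  have le: "w i \<le> w z"
    if iV: "i \<in> verts G" and "\<rho>1 \<in> Rec G z" "\<rho>2 \<in> Rec G z"
      "\<forall>i\<in>verts G - {z}. \<rho>2 i = \<rho>1 i - laplacian G w i" for i w \<rho>1 \<rho>2
  proof (rule ccontr)
    assume "\<not> w i \<le> w z"
    then have "w z < w i" by simp
    moreover have "burnable z \<rho>1" using that(2) unfolding Rec_iff by blast
    ultimately obtain j where j: "j \<in> verts G - {z}" "deg G j \<le> \<rho>1 j - laplacian G w j"
      using burnable_max_principle[OF _ iV] by blast
    moreover have "\<rho>2 j \<le> deg G j - 1" using that(3) j(1) unfolding Rec_iff by blast
    ultimately show False using that(4) by simp
  qed
  obtain u where u: "\<forall>i\<in>verts G - {z}. \<rho> i = \<rho>' i + laplacian G u i"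
    using assms(4) unfolding equiv_off_def by blast
  have const: "u i = u z" if "i \<in> verts G" for i
  proof (rule antisym)
    show "u i \<le> u z" by (rule le[OF that assms(2,3)]) (use u in simp)
    have "- u i \<le> - u z"
      by (rule le[OF that assms(3,2)]) (use u in \<open>simp add: laplacian_uminus\<close>)
    then show "u z \<le> u i" by simp
  qed
  have "\<rho> i = \<rho>' i" if "i \<in> verts G" for i
  proof (cases "i = z")
    case False
    have "laplacian G u i = 0"
      using laplacian_cong[of u "\<lambda>_. u z" i] const that by (simp add: laplacian_const)
    then show ?thesis using u that False by simp
  qed (use assms Rec_iff in simp)
  moreover have "\<rho> i = \<rho>' i" if "i \<notin> verts G" for i
    using that assms Rec_iff by (simp add: sandpiles_def)
  ultimately show ?thesis by blast
qed

lemma finite_Rec: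
  assumes z: "z \<in> verts G"
  shows "finite (Rec G z)"
proof -
  have pos: "0 \<le> \<rho> i" if \<rho>: "\<rho> \<in> Rec G z" and i: "i \<in> verts G - {z}" for \<rho> i
  proof -
    have "burnable z \<rho>" using \<rho> Rec_iff by blast
    \<comment> \<open>The burning criterion for a single vertex shows that its height is nonnegative.\<close>
    then have "deg G i \<le> \<rho> i - laplacian G (\<lambda>j. of_bool (j \<in> {i})) i"
      unfolding burnable_def using i by (auto dest: spec[of _ "{i}"])
    moreover have "- deg G i \<le> laplacian G (\<lambda>j. of_bool (j \<in> {i})) i"
      by (auto simp: laplacian_def intro!: sum_nonneg)
    ultimately show ?thesis by simp
  qed
  define D where "D = Max (deg G ` verts G)"
  have D: "deg G i \<le> D" if "i \<in> verts G" for i using that by (simp add: D_def)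
  have "Rec G z \<subseteq> {\<rho>. \<forall>i. (i \<in> verts G \<longrightarrow> \<rho> i \<in> {0..D}) \<and> (i \<notin> verts G \<longrightarrow> \<rho> i = 0)}"
  proof safe
    fix \<rho> i assume \<rho>: "\<rho> \<in> Rec G z" and i: "i \<in> verts G"
    show "\<rho> i \<in> {0..D}"
    proof (cases "i = z")
      case True
      then show ?thesis using \<rho> Rec_iff D[OF i] by (simp add: deg_def)
    next
      case False
      then have "\<rho> i \<le> deg G i - 1" using \<rho> i unfolding Rec_iff by blast
      then show ?thesis using i False pos[OF \<rho>, of i] D[OF i] by simp
    qed
  next
    fix \<rho> i assume "\<rho> \<in> Rec G z" "i \<notin> verts G"
    then show "\<rho> i = 0" using Rec_iff by (simp add: sandpiles_def)
  qed
  then show ?thesis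
    by (rule finite_subset) (intro finite_set_of_finite_funs; simp)
qed

text \<open>
  Start from an equivalent sandpile that is stable off \<open>z\<close> and fire backwards as much as
  stability off \<open>z\<close> permits. The strictly subharmonic function bounds the possible amounts
  \<open>w\<close>, so one with maximal total exists. For it the burning criterion holds, since a violating
  set \<open>B\<close> could be fired backwards once more.
\<close>

lemma exists_equiv_Rec:
  assumes z: "z \<in> verts G"
  shows "\<exists>\<rho>\<in>Rec G z. equiv_off z s \<rho>"
proof -
  obtain v where v: "\<And>i. i \<in> verts G - {z} \<Longrightarrow> 1 \<le> laplacian G v i"
    using exists_subharmonic_off[OF z] by blast
  have bound: "\<exists>C\<ge>0. \<forall>i\<in>verts G. f i \<le> C" for f :: "'a \<Rightarrow> int"
    by (rule exI[of _ "max 0 (Max (f ` verts G))"]) (auto simp: le_max_iff_disj)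
  have mult: "C \<le> C * laplacian G v i" if "0 \<le> C" "i \<in> verts G - {z}" for C i
    using mult_left_mono[OF v[OF that(2)] that(1)] by simp
  obtain C where C: "0 \<le> C" "\<And>i. i \<in> verts G \<Longrightarrow> s i - deg G i + 1 \<le> C"
    using bound[of "\<lambda>i. s i - deg G i + 1"] by blast
  define s1 where "s1 j = s j - laplacian G (\<lambda>k. C * v k) j" for j
  have s1: "s1 i \<le> deg G i - 1" if "i \<in> verts G - {z}" for i
    using mult[OF C(1) that] C(2)[of i] that by (simp add: s1_def laplacian_scale)
  define W where "W = {w. (\<forall>i\<in>verts G. 0 \<le> w i) \<and> w z = 0 \<and>
    (\<forall>i\<in>verts G - {z}. s1 i - laplacian G w i \<le> deg G i - 1)}"
  obtain K where K: "0 \<le> K" "\<And>i. i \<in> verts G \<Longrightarrow> deg G i - 1 - s1 i + 1 \<le> K"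
    using bound[of "\<lambda>i. deg G i - 1 - s1 i + 1"] by blast
  have W_le: "w i \<le> K * (v z - v i)" if w: "w \<in> W" and i: "i \<in> verts G" for w i
  proof (rule ccontr)
    assume neg: "\<not> ?thesis"
    \<comment> \<open>\<open>K\<close> is chosen such that \<open>f\<close> is strictly subharmonic off \<open>z\<close>,
      so its maximum can only be attained at \<open>z\<close>.\<close>
    define f where "f j = w j + K * v j" for j
    define m where "m = Max (f ` verts G)"
    have le: "f j \<le> m" if "j \<in> verts G" for j using that by (simp add: m_def)
    have "m \<in> f ` verts G" unfolding m_def using i by (intro Max_in) auto
    then obtain j where j: "j \<in> verts G" "f j = m" by auto
    have "f z < m" using neg le[OF i] w by (simp add: f_def W_def algebra_simps)
    then have jz: "j \<in> verts G - {z}" using j by auto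
    have "laplacian G f j \<le> laplacian G (\<lambda>_. m) j"
      using j le by (intro laplacian_mono) auto
    then have "laplacian G w j + K * laplacian G v j \<le> 0"
      unfolding f_def by (simp add: laplacian_const laplacian_add laplacian_scale)
    moreover have "s1 j - laplacian G w j \<le> deg G j - 1"
      using w jz by (auto simp: W_def)
    ultimately show False using mult[OF K(1) jz] K(2)[OF j(1)] by simp
  qed
  have "(\<lambda>_. 0) \<in> W" using s1 by (auto simp: W_def laplacian_const)
  moreover have "nat (\<Sum>i\<in>verts G. w i) \<le> nat (\<Sum>i\<in>verts G. K * (v z - v i))" if "w \<in> W" for w
    using W_le[OF that] by (intro nat_mono sum_mono) auto
  ultimately obtain w where w: "w \<in> W"
    and max: "\<And>w'. w' \<in> W \<Longrightarrow> nat (\<Sum>i\<in>verts G. w' i) \<le> nat (\<Sum>i\<in>verts G. w i)"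
    using ex_has_greatest_nat[of "\<lambda>w. w \<in> W" "\<lambda>_. 0" "\<lambda>w. nat (\<Sum>i\<in>verts G. w i)"
      "Suc (nat (\<Sum>i\<in>verts G. K * (v z - v i)))"] by (meson le_imp_less_Suc)
  define \<rho> where "\<rho> i = (if i = z then deg G z else if i \<in> verts G then s1 i - laplacian G w i else 0)" for i
  have \<rho>_off: "\<rho> i = s1 i - laplacian G w i" if "i \<in> verts G - {z}" for i
    using that by (simp add: \<rho>_def)
  have "burnable z \<rho>"
    unfolding burnable_def
  proof (intro allI impI, rule ccontr)
    fix B assume B: "B \<subseteq> verts G - {z} \<and> B \<noteq> {}"
    let ?b = "\<lambda>j. of_bool (j \<in> B) :: int"
    assume no: "\<not> (\<exists>i\<in>B. deg G i \<le> \<rho> i - laplacian G ?b i)"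
    have "s1 i - laplacian G (\<lambda>j. w j + ?b j) i \<le> deg G i - 1" if i: "i \<in> verts G - {z}" for i
    proof (cases "i \<in> B")
      case True
      then have "\<rho> i - laplacian G ?b i < deg G i" using no by (simp add: not_le)
      then show ?thesis using \<rho>_off[OF i] by (simp add: laplacian_add)
    next
      case False
      then have "0 \<le> laplacian G ?b i" by (auto simp: laplacian_def intro!: sum_nonneg)
      moreover have "s1 i - laplacian G w i \<le> deg G i - 1" using w i by (auto simp: W_def)
      ultimately show ?thesis by (simp add: laplacian_add)
    qed
    then have "(\<lambda>j. w j + ?b j) \<in> W" using w B by (auto simp: W_def)
    then have "nat (\<Sum>i\<in>verts G. w i + ?b i) \<le> nat (\<Sum>i\<in>verts G. w i)" by (rule max)
    moreover have "0 \<le> (\<Sum>i\<in>verts G. w i)" using w by (auto simp: W_def intro: sum_nonneg)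
    moreover obtain b where b: "b \<in> B" "b \<in> verts G" using B by blast
    then have "0 < (\<Sum>i\<in>verts G. ?b i)" by (intro sum_pos2[of _ b]) auto
    ultimately show False by (simp add: sum.distrib)
  qed
  moreover have "\<rho> \<in> sandpiles G" using z by (auto simp: \<rho>_def sandpiles_def)
  moreover have "\<forall>i\<in>verts G - {z}. \<rho> i \<le> deg G i - 1" using \<rho>_off w by (auto simp: W_def)
  ultimately have "\<rho> \<in> Rec G z" using Rec_iff by (simp add: \<rho>_def)
  moreover have "equiv_off z s \<rho>"
    unfolding equiv_off_def
    by (rule exI[of _ "\<lambda>k. C * v k + w k"])
       (simp add: \<rho>_off laplacian_add s1_def)
  ultimately show ?thesis by blast
qed

definition rec_rep :: "'a \<Rightarrow> ('a \<Rightarrow> int) \<Rightarrow> 'a \<Rightarrow> int" where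
  "rec_rep z s = (THE \<rho>. \<rho> \<in> Rec G z \<and> equiv_off z s \<rho>)"

lemma rec_rep_unique:
  assumes "z \<in> verts G" "\<rho> \<in> Rec G z" "equiv_off z s \<rho>"
  shows "rec_rep z s = \<rho>"
  unfolding rec_rep_def
proof (rule the_equality)
  fix \<rho>' assume "\<rho>' \<in> Rec G z \<and> equiv_off z s \<rho>'"
  then show "\<rho>' = \<rho>"
    using assms Rec_equiv_off_unique equiv_off_sym equiv_off_trans by blast
qed (use assms in blast)

lemma rec_rep:
  assumes "z \<in> verts G"
  shows "rec_rep z s \<in> Rec G z" "equiv_off z s (rec_rep z s)"
proof -
  obtain \<rho> where "\<rho> \<in> Rec G z" "equiv_off z s \<rho>" using exists_equiv_Rec[OF assms] by blast
  then show "rec_rep z s \<in> Rec G z" "equiv_off z s (rec_rep z s)"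
    using rec_rep_unique[OF assms] by simp_all
qed

lemma rec_rep_eq_iff:
  assumes "z \<in> verts G"
  shows "rec_rep z s = rec_rep z t \<longleftrightarrow> equiv_off z s t"
proof
  assume "rec_rep z s = rec_rep z t"
  then have "equiv_off z s (rec_rep z t)" using rec_rep(2)[OF assms, of s] by simp
  then show "equiv_off z s t"
    by (rule equiv_off_trans) (rule equiv_off_sym[OF rec_rep(2)[OF assms]])
next
  assume "equiv_off z s t"
  then show "rec_rep z s = rec_rep z t"
    using rec_rep_unique[OF assms rec_rep(1)[OF assms]]
      equiv_off_trans[OF _ rec_rep(2)[OF assms]] by simp
qed

section \<open>Stabilizability\<close>

lemma topplings_result:
  assumes "topplings G s is t"
  shows "t i = s i + laplacian G (\<lambda>j. int (count_list is j)) i"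
  using assms
proof induction
  case (Nil s)
  then show ?case by (simp add: laplacian_const)
next
  case (Cons s x xs t)
  then show ?case by (simp only: laplacian_count_Cons) (simp add: topple_def)
qed

lemma unstable_dominated:
  assumes "unstable G s i" and u: "\<forall>j\<in>verts G. 0 \<le> u j" "s i + laplacian G u i \<le> deg G i - 1"
  shows "1 \<le> u i"
proof (rule ccontr)
  assume "\<not> 1 \<le> u i"
  then have "u i = 0" using assms by (force simp: unstable_def)
  then have "0 \<le> laplacian G u i" using u by (auto simp: laplacian_def intro!: sum_nonneg)
  then show False using assms by (simp add: unstable_def)
qed

lemma topple_dominated:
  assumes "unstable G s i" "\<forall>j\<in>verts G. 0 \<le> u j"
    and "\<forall>j\<in>verts G. s j + laplacian G u j \<le> deg G j - 1"
  shows "\<forall>j\<in>verts G. 0 \<le> u j - \<delta> i j"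
    and "\<forall>j\<in>verts G. topple G s i j + laplacian G (\<lambda>j. u j - \<delta> i j) j \<le> deg G j - 1"
  using assms unstable_dominated[OF assms(1,2)]
  by (auto simp: topple_def laplacian_diff unstable_def) (auto simp: \<delta>_def)

text \<open>
  The least action principle: a toppling vertex is unstable, so every nonnegative \<open>u\<close> that leads to a stable
  sandpile has to fire it as well, and one can subtract this firing from \<open>u\<close>.
\<close>

lemma least_action:
  assumes "topplings G s is t" "\<forall>j\<in>verts G. 0 \<le> u j"
    "\<forall>j\<in>verts G. s j + laplacian G u j \<le> deg G j - 1" "i \<in> verts G"
  shows "int (count_list is i) \<le> u i"
  using assms
proof (induction arbitrary: u)
  case (Cons s x xs t)
  from Cons.IH[OF topple_dominated[OF Cons.hyps(1) Cons.prems(1,2)] Cons.prems(3)]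
  show ?case by (simp only: count_list_Cons_delta)
qed simp

lemma stabilizes_to_unique:
  assumes "stabilizes_to G s t" "stabilizes_to G s t'"
  shows "t = t'"
proof -
  obtain "is" js where 1: "topplings G s is t" "topplings G s js t'"
    "\<forall>i\<in>verts G. t i \<le> deg G i - 1" "\<forall>i\<in>verts G. t' i \<le> deg G i - 1"
    using assms unfolding stabilizes_to_def by blast
  have eq: "count_list is i = count_list js i" if "i \<in> verts G" for i
    using least_action[OF 1(1), of "\<lambda>j. int (count_list js j)" i]
      least_action[OF 1(2), of "\<lambda>j. int (count_list is j)" i]
      topplings_result[OF 1(1)] topplings_result[OF 1(2)] 1(3,4) that by simp
  have "laplacian G (\<lambda>j. int (count_list is j)) i = laplacian G (\<lambda>j. int (count_list js j)) i" for i
    using eq by (cases "i \<in> verts G") (auto intro: laplacian_cong simp: laplacian_outside)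
  then show ?thesis
    using topplings_result[OF 1(1)] topplings_result[OF 1(2)] by auto
qed

lemma stabilization_stabilizes: "stabilizable G s \<Longrightarrow> stabilizes_to G s (stabilization G s)"
  unfolding stabilizable_def stabilization_def using stabilizes_to_unique by (metis theI)

lemma stabilizable_if_dominated:
  assumes "\<forall>j\<in>verts G. 0 \<le> u j" "\<forall>j\<in>verts G. s j + laplacian G u j \<le> deg G j - 1"
  shows "stabilizable G s"
  using assms
proof (induction "nat (\<Sum>j\<in>verts G. u j)" arbitrary: s u rule: less_induct)
  case less
  show ?case
  proof (cases "\<exists>i. unstable G s i")
    case False
    then have "stabilizes_to G s s"
      by (auto simp: stabilizes_to_def unstable_def not_le intro: topplings.Nil)
    then show ?thesis unfolding stabilizable_def by blast
  next
    case True
    then obtain i where i: "unstable G s i" by blast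
    then have iV: "i \<in> verts G" by (simp add: unstable_def)
    note d = topple_dominated[OF i less.prems]
    have "(\<Sum>j\<in>verts G. u j - \<delta> i j) = (\<Sum>j\<in>verts G. u j) - 1"
      using iV by (simp add: sum_subtractf \<delta>_def)
    moreover have "0 \<le> (\<Sum>j\<in>verts G. u j - \<delta> i j)" using d(1) by (intro sum_nonneg) auto
    ultimately have "nat (\<Sum>j\<in>verts G. u j - \<delta> i j) < nat (\<Sum>j\<in>verts G. u j)" by linarith
    then have "stabilizable G (topple G s i)" using less.hyps d by blast
    then show ?thesis
      using i unfolding stabilizable_def stabilizes_to_def by (metis topplings.Cons)
  qed
qed

text \<open>
  By the least action principle, legality of the topplings does not matter: it suffices that some
  \<open>u\<close> leads to a stable sandpile, and \<open>u\<close> may be taken nonnegative since constants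
  have Laplacian 0. Hence stabilizability is invariant under firings.
\<close>

lemma stabilizable_iff:
  "stabilizable G s \<longleftrightarrow> (\<exists>u. \<forall>j\<in>verts G. s j + laplacian G u j \<le> deg G j - 1)"
proof
  assume "stabilizable G s"
  then obtain "is" t where "topplings G s is t" "\<forall>i\<in>verts G. t i \<le> deg G i - 1"
    unfolding stabilizable_def stabilizes_to_def by blast
  then show "\<exists>u. \<forall>j\<in>verts G. s j + laplacian G u j \<le> deg G j - 1"
    using topplings_result[of s "is" t] by (intro exI[of _ "\<lambda>j. int (count_list is j)"]) simp
next
  assume "\<exists>u. \<forall>j\<in>verts G. s j + laplacian G u j \<le> deg G j - 1"
  then obtain u where u: "\<forall>j\<in>verts G. s j + laplacian G u j \<le> deg G j - 1" by blast
  define c where "c = Min (u ` verts G)"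
  show "stabilizable G s"
  proof (rule stabilizable_if_dominated)
    show "\<forall>j\<in>verts G. 0 \<le> u j - c" by (simp add: c_def)
    show "\<forall>j\<in>verts G. s j + laplacian G (\<lambda>j. u j - c) j \<le> deg G j - 1"
      using u by (simp add: laplacian_diff laplacian_const)
  qed
qed

lemma stabilizable_add_laplacian:
  "stabilizable G (\<lambda>j. s j + laplacian G u j) \<longleftrightarrow> stabilizable G s"
proof -
  have *: "stabilizable G s" if "stabilizable G (\<lambda>j. s j + laplacian G u j)" for s u
    using that unfolding stabilizable_iff by (auto simp: add.assoc simp flip: laplacian_add)
  show ?thesis
    using *[of s u] *[of "\<lambda>j. s j + laplacian G u j" "\<lambda>j. - u j"] by (auto simp: laplacian_uminus)
qed

lemma stabilizable_cong:
  assumes "\<And>j. j \<in> verts G \<Longrightarrow> s j = t j"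
  shows "stabilizable G s \<longleftrightarrow> stabilizable G t"
  using assms by (simp add: stabilizable_iff)

lemma stabilizable_antimono:
  assumes "stabilizable G t" "\<And>j. j \<in> verts G \<Longrightarrow> s j \<le> t j"
  shows "stabilizable G s"
proof -
  obtain u where "\<forall>j\<in>verts G. t j + laplacian G u j \<le> deg G j - 1"
    using assms(1) unfolding stabilizable_iff by blast
  then have "\<forall>j\<in>verts G. s j + laplacian G u j \<le> deg G j - 1" using assms(2) by fastforce
  then show ?thesis unfolding stabilizable_iff by blast
qed

text \<open>
  Up to firings, \<open>s\<close> is its recurrent representative \<open>\<rho>\<close> with \<open>m = mass G s - mass G \<rho>\<close>
  chips added at \<open>z\<close>. As \<open>\<rho> z = deg G z\<close>, this is stable for negative \<open>m\<close>. For
  \<open>m \<ge> 0\<close> no \<open>w\<close> can stabilize it: the maximum principle forces \<open>w\<close> to be minimal at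
  \<open>z\<close>, and then firing \<open>w\<close> does not lower the height of \<open>z\<close>.
\<close>

lemma stabilizable_iff_mass:
  assumes z: "z \<in> verts G"
  shows "stabilizable G s \<longleftrightarrow> mass G s < mass G (rec_rep z s)"
proof -
  define \<rho> where "\<rho> = rec_rep z s"
  have \<rho>: "\<rho> z = deg G z" "\<And>i. i \<in> verts G - {z} \<Longrightarrow> \<rho> i \<le> deg G i - 1" "burnable z \<rho>"
    using rec_rep(1)[OF z, of s] Rec_iff by (auto simp: \<rho>_def)
  obtain u where u: "\<And>i. i \<in> verts G - {z} \<Longrightarrow> s i = \<rho> i + laplacian G u i"
    using rec_rep(2)[OF z, of s] unfolding equiv_off_def \<rho>_def by blast
  define m where "m = s z - \<rho> z - laplacian G u z"
  define t where "t j = \<rho> j + m * \<delta> z j" for j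
  have s: "s j = t j + laplacian G u j" if "j \<in> verts G" for j
    using u[of j] that by (auto simp: t_def m_def \<delta>_def)
  have "mass G s = mass G (\<lambda>j. t j + laplacian G u j)"
    unfolding mass_def using s by (rule sum.cong[OF refl])
  then have mass: "mass G s = mass G \<rho> + m"
    by (simp add: mass_add_laplacian) (simp add: t_def mass_delta[OF z])
  have "stabilizable G s \<longleftrightarrow> stabilizable G t"
    using stabilizable_cong[of s "\<lambda>j. t j + laplacian G u j"] s
    by (simp add: stabilizable_add_laplacian)
  also have "\<dots> \<longleftrightarrow> m < 0"
  proof
    assume "m < 0"
    then have "\<forall>j\<in>verts G. t j + laplacian G (\<lambda>_. 0) j \<le> deg G j - 1"
      using \<rho> by (auto simp: t_def \<delta>_def laplacian_const)
    then show "stabilizable G t" unfolding stabilizable_iff by blast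
  next
    assume "stabilizable G t"
    then obtain w where w: "\<And>j. j \<in> verts G \<Longrightarrow> t j + laplacian G w j \<le> deg G j - 1"
      unfolding stabilizable_iff by blast
    have "- w j \<le> - w z" if jV: "j \<in> verts G" for j
    proof (rule ccontr)
      assume "\<not> - w j \<le> - w z"
      then obtain i where "i \<in> verts G - {z}" "deg G i \<le> \<rho> i - laplacian G (\<lambda>j. - w j) i"
        using burnable_max_principle[OF \<rho>(3) jV, of "\<lambda>j. - w j"] by auto
      then show False using w[of i] by (auto simp: t_def \<delta>_def laplacian_uminus)
    qed
    then have "laplacian G (\<lambda>_. w z) z \<le> laplacian G w z" by (intro laplacian_mono) auto
    then show "m < 0" using w[OF z] \<rho>(1) by (simp add: t_def \<delta>_def laplacian_const)
  qed
  finally show ?thesis using mass by (simp add: \<rho>_def)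
qed

end

section \<open>Random walks by bijections of a finite set\<close>

text \<open>
  The transition operator of the walk that moves from \<open>x\<close> to \<open>E i x\<close> with probability \<open>p i\<close>:
  the expectation of \<open>h\<close> after one step from \<open>x\<close>.
\<close>

definition averaging :: "('v \<Rightarrow> real) \<Rightarrow> 'v set \<Rightarrow> ('v \<Rightarrow> 'r \<Rightarrow> 'r) \<Rightarrow> ('r \<Rightarrow> real) \<Rightarrow> 'r \<Rightarrow> real" where
  "averaging p V E h x = (\<Sum>i\<in>V. p i * h (E i x))"

locale finite_bijection_walk =
  fixes R :: "'r set" and V :: "'v set" and p :: "'v \<Rightarrow> real" and E :: "'v \<Rightarrow> 'r \<Rightarrow> 'r" and z :: 'v
  assumes finite_R: "finite R" and R_ne: "R \<noteq> {}" and finite_V: "finite V"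
    and p_pos: "\<And>i. i \<in> V \<Longrightarrow> 0 < p i" and p_sum: "(\<Sum>i\<in>V. p i) = 1"
    and bij: "\<And>i. i \<in> V \<Longrightarrow> bij_betw (E i) R R"
    and z: "z \<in> V" and lazy: "\<And>x. x \<in> R \<Longrightarrow> E z x = x"
    and reach: "\<And>x y. x \<in> R \<Longrightarrow> y \<in> R \<Longrightarrow> \<exists>w. set w \<subseteq> V \<and> fold E w x = y"
begin

abbreviation T :: "('r \<Rightarrow> real) \<Rightarrow> 'r \<Rightarrow> real" where
  "T \<equiv> averaging p V E"

lemma p_nonneg: "i \<in> V \<Longrightarrow> 0 \<le> p i"
  using p_pos by (simp add: less_imp_le)

lemma E_in: "i \<in> V \<Longrightarrow> x \<in> R \<Longrightarrow> E i x \<in> R"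
  using bij by (auto simp: bij_betw_def)

text \<open>
  The steps are bijections, so the uniform distribution is stationary.
\<close>

lemma sum_averaging_pow: "(\<Sum>x\<in>R. (T ^^ k) h x) = (\<Sum>x\<in>R. h x)"
proof (induction k)
  case (Suc k)
  let ?g = "(T ^^ k) h"
  have "(\<Sum>x\<in>R. (T ^^ Suc k) h x) = (\<Sum>i\<in>V. p i * (\<Sum>x\<in>R. ?g (E i x)))"
    by (simp add: averaging_def sum_distrib_left sum.swap[of _ R V])
  also have "\<dots> = (\<Sum>i\<in>V. p i * (\<Sum>x\<in>R. ?g x))"
    by (intro sum.cong refl arg_cong2[of _ _ _ _ "(*)"] sum.reindex_bij_betw bij)
  also have "\<dots> = (\<Sum>x\<in>R. h x)"
    using Suc by (simp add: p_sum flip: sum_distrib_right)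
  finally show ?case .
qed simp

lemma averaging_pow_bounds:
  assumes "\<And>x. x \<in> R \<Longrightarrow> m \<le> h x \<and> h x \<le> M" "x \<in> R"
  shows "m \<le> (T ^^ k) h x \<and> (T ^^ k) h x \<le> M"
  using assms(2)
proof (induction k arbitrary: x)
  case (Suc k)
  define g where "g = (T ^^ k) h"
  have g: "m \<le> g (E i x) \<and> g (E i x) \<le> M" if "i \<in> V" for i
    using Suc.IH E_in[OF that Suc.prems] by (simp add: g_def)
  have "(\<Sum>i\<in>V. p i * m) \<le> T g x" "T g x \<le> (\<Sum>i\<in>V. p i * M)"
    unfolding averaging_def using g p_nonneg by (auto intro!: sum_mono mult_left_mono)
  then show ?case by (simp add: g_def p_sum flip: sum_distrib_right)
qed (use assms in simp)

lemma averaging_pow_along_word: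
  assumes w: "set w \<subseteq> V" and a: "0 \<le> a" "\<And>i. i \<in> V \<Longrightarrow> a \<le> p i"
    and h: "\<And>x. x \<in> R \<Longrightarrow> m \<le> h x" and x: "x \<in> R"
  shows "m + a ^ length w * (h (fold E w x) - m) \<le> (T ^^ length w) h x"
  using w x
proof (induction w arbitrary: x)
  case (Cons i w)
  let ?g = "(T ^^ length w) h"
  have i: "i \<in> V" and w: "set w \<subseteq> V" using Cons.prems by auto
  have g: "m \<le> ?g y" if "y \<in> R" for y
    using averaging_pow_bounds[of m h "Max (h ` R)" y] h that finite_R by simp
  have "a ^ length (i # w) * (h (fold E (i # w) x) - m)
      = a * (a ^ length w * (h (fold E w (E i x)) - m))" by simp
  also have "\<dots> \<le> a * (?g (E i x) - m)"
    using Cons.IH[OF w E_in[OF i Cons.prems(2)]] a by (intro mult_left_mono) auto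
  also have "\<dots> \<le> p i * (?g (E i x) - m)"
    using a(2)[OF i] g[OF E_in[OF i Cons.prems(2)]] by (intro mult_right_mono) auto
  also have "\<dots> \<le> (\<Sum>j\<in>V. p j * (?g (E j x) - m))"
    using i g E_in Cons.prems(2) p_nonneg finite_V
    by (intro member_le_sum) (auto intro!: mult_nonneg_nonneg)
  also have "\<dots> = T ?g x - m"
    by (simp add: averaging_def right_diff_distrib sum_subtractf p_sum flip: sum_distrib_right)
  finally show ?case by simp
qed simp

text \<open>
  Words can be padded with the idle letter \<open>z\<close>, so the walk is aperiodic.
\<close>

lemma common_length:
  "\<exists>L. \<forall>x\<in>R. \<forall>y\<in>R. \<exists>w. set w \<subseteq> V \<and> length w = L \<and> fold E w x = y"
proof -
  obtain W where W: "\<And>x y. x \<in> R \<Longrightarrow> y \<in> R \<Longrightarrow> set (W x y) \<subseteq> V \<and> fold E (W x y) x = y"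
    using reach by metis
  define L where "L = Max ((\<lambda>(x, y). length (W x y)) ` (R \<times> R))"
  have idle: "fold E (replicate n z) x = x" if "x \<in> R" for n x
    using that lazy by (induction n) auto
  have "\<exists>w. set w \<subseteq> V \<and> length w = L \<and> fold E w x = y" if xy: "x \<in> R" "y \<in> R" for x y
  proof (intro exI conjI)
    let ?w = "W x y @ replicate (L - length (W x y)) z"
    have "length (W x y) \<le> L"
      unfolding L_def using finite_R xy by (intro Max_ge) auto
    then show "length ?w = L" by simp
    show "set ?w \<subseteq> V" using W[OF xy] z by (auto simp: set_replicate_conv_if)
    show "fold E ?w x = y" using W[OF xy] idle[OF xy(2)] by simp
  qed
  then show ?thesis by blast
qed

text \<open>
  After \<open>L\<close> steps the walk is, from every point, at a maximum point of \<open>h\<close> with probability at least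
  \<open>a ^ L\<close>, which shrinks the range of \<open>h\<close> by the factor \<open>1 - a ^ L\<close>. The mean over \<open>R\<close>
  is preserved and stays within the range.
\<close>

theorem averaging_pow_tendsto_mean:
  assumes "0 < \<epsilon>"
  shows "\<exists>N. \<forall>k\<ge>N. \<forall>x\<in>R. \<bar>(T ^^ k) h x - (\<Sum>y\<in>R. h y) / card R\<bar> \<le> \<epsilon>"
proof -
  obtain L where L: "\<And>x y. x \<in> R \<Longrightarrow> y \<in> R \<Longrightarrow>
      \<exists>w. set w \<subseteq> V \<and> length w = L \<and> fold E w x = y"
    using common_length by blast
  define a where "a = Min (p ` V)"
  have a_le: "a \<le> p i" if "i \<in> V" for i using that finite_V by (simp add: a_def)
  have "a \<in> p ` V" unfolding a_def using finite_V z by (intro Min_in) auto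
  then have a_pos: "0 < a" using p_pos by auto
  have "p z \<le> 1" using member_le_sum[OF z, of p] finite_V p_pos p_sum by (auto intro: less_imp_le)
  then have a1: "a \<le> 1" using a_le[OF z] by simp
  define c where "c = 1 - a ^ L"
  have c: "0 \<le> c" "c < 1" using a_pos a1 by (auto simp: c_def power_le_one)
  have shrink: "\<exists>m'. \<forall>x\<in>R. m' \<le> (T ^^ L) g x \<and> (T ^^ L) g x \<le> m' + c * d"
    if g: "\<And>x. x \<in> R \<Longrightarrow> m \<le> g x \<and> g x \<le> m + d" for g m d
  proof -
    define M where "M = Max (g ` R)"
    have "M \<in> g ` R" unfolding M_def using finite_R R_ne by (intro Max_in) auto
    then obtain y where y: "y \<in> R" "g y = M" by auto
    have gM: "g x \<le> M" if "x \<in> R" for x using that finite_R by (simp add: M_def)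
    have "m + a ^ L * (M - m) \<le> (T ^^ L) g x \<and> (T ^^ L) g x \<le> (m + a ^ L * (M - m)) + c * d"
      if x: "x \<in> R" for x
    proof
      obtain w where "set w \<subseteq> V" "length w = L" "fold E w x = y" using L[OF x y(1)] by blast
      then show "m + a ^ L * (M - m) \<le> (T ^^ L) g x"
        using averaging_pow_along_word[of w a m g x] a_pos a_le g x y by auto
      have "(T ^^ L) g x \<le> M" using averaging_pow_bounds[of m g M x L] g gM x by blast
      also have "M = (m + a ^ L * (M - m)) + c * (M - m)" by (simp add: c_def algebra_simps)
      also have "\<dots> \<le> (m + a ^ L * (M - m)) + c * d"
        using g[OF y(1)] y(2) c(1) by (intro add_left_mono mult_left_mono) auto
      finally show "(T ^^ L) g x \<le> (m + a ^ L * (M - m)) + c * d" .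
    qed
    then show ?thesis by blast
  qed
  define m0 where "m0 = Min (h ` R)"
  define D where "D = Max (h ` R) - m0"
  have D: "m0 \<le> h x \<and> h x \<le> m0 + D" if "x \<in> R" for x
    using that finite_R by (simp add: m0_def D_def)
  have iter: "\<exists>m. \<forall>x\<in>R. m \<le> (T ^^ (L * q)) h x \<and> (T ^^ (L * q)) h x \<le> m + c ^ q * D" for q
  proof (induction q)
    case 0
    then show ?case using D by auto
  next
    case (Suc q)
    then obtain m where "\<And>x. x \<in> R \<Longrightarrow>
        m \<le> (T ^^ (L * q)) h x \<and> (T ^^ (L * q)) h x \<le> m + c ^ q * D" by blast
    from shrink[OF this] show ?case by (simp add: funpow_add mult.assoc)
  qed
  have "(\<lambda>q. c ^ q * D) \<longlonglongrightarrow> 0 * D"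
    using c by (intro tendsto_mult tendsto_const LIMSEQ_realpow_zero)
  then have "\<forall>\<^sub>F q in sequentially. c ^ q * D < \<epsilon>"
    using assms by (intro order_tendstoD(2)[of _ "0 * D"]) auto
  then obtain q where q: "c ^ q * D < \<epsilon>" by (auto simp: eventually_sequentially)
  obtain m where m: "\<And>x. x \<in> R \<Longrightarrow>
      m \<le> (T ^^ (L * q)) h x \<and> (T ^^ (L * q)) h x \<le> m + c ^ q * D" using iter by blast
  have "\<bar>(T ^^ k) h x - (\<Sum>y\<in>R. h y) / card R\<bar> \<le> \<epsilon>" if k: "L * q \<le> k" and x: "x \<in> R" for k x
  proof -
    have "(T ^^ k) h = (T ^^ (k - L * q)) ((T ^^ (L * q)) h)"
      using k by (metis comp_apply funpow_add le_add_diff_inverse2)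
    then have b: "m \<le> (T ^^ k) h y \<and> (T ^^ k) h y \<le> m + c ^ q * D" if "y \<in> R" for y
      using averaging_pow_bounds[of m "(T ^^ (L * q)) h" "m + c ^ q * D" y "k - L * q"] m that
      by simp
    have card: "0 < real (card R)" using finite_R R_ne by (simp add: card_gt_0_iff)
    have "card R * m \<le> (\<Sum>y\<in>R. (T ^^ k) h y)"
      using b by (intro sum_bounded_below) auto
    moreover have "(\<Sum>y\<in>R. (T ^^ k) h y) \<le> card R * (m + c ^ q * D)"
      using b by (intro sum_bounded_above) auto
    ultimately have "m \<le> (\<Sum>y\<in>R. h y) / card R" "(\<Sum>y\<in>R. h y) / card R \<le> m + c ^ q * D"
      using card unfolding sum_averaging_pow by (simp_all add: field_simps)
    then show ?thesis using b[OF x] q by linarith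
  qed
  then show ?thesis by blast
qed

end

section \<open>The recurrent representative of the closed chain\<close>

context eulerian_digraph
begin

definition rec_step :: "'a \<Rightarrow> 'a \<Rightarrow> ('a \<Rightarrow> int) \<Rightarrow> 'a \<Rightarrow> int" where
  "rec_step z i \<rho> = rec_rep z (\<lambda>j. \<rho> j + \<delta> i j)"

lemma rec_step_rec_rep:
  assumes "z \<in> verts G"
  shows "rec_step z i (rec_rep z s) = rec_rep z (\<lambda>j. s j + \<delta> i j)"
  unfolding rec_step_def rec_rep_eq_iff[OF assms]
  by (rule equiv_off_add[OF equiv_off_sym[OF rec_rep(2)[OF assms]]])

lemma rec_rep_Rec: "z \<in> verts G \<Longrightarrow> \<rho> \<in> Rec G z \<Longrightarrow> rec_rep z \<rho> = \<rho>"
  by (rule rec_rep_unique) (auto simp: equiv_off_def intro!: exI[of _ "\<lambda>_. 0"] simp: laplacian_const)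

lemma fold_rec_step:
  assumes "z \<in> verts G"
  shows "fold (rec_step z) w (rec_rep z s) = rec_rep z (\<lambda>j. s j + int (count_list w j))"
proof (induction w arbitrary: s)
  case (Cons i w)
  have "(\<lambda>j. s j + int (count_list (i # w) j)) = (\<lambda>j. (s j + \<delta> i j) + int (count_list w j))"
    unfolding count_list_Cons_delta by (simp add: add.assoc)
  then show ?case using Cons by (simp add: rec_step_rec_rep[OF assms])
qed simp

lemma exists_word_with_counts:
  assumes "finite V"
  shows "\<exists>w. set w \<subseteq> V \<and> (\<forall>i\<in>V. count_list w i = c i)"
  using assms
proof (induction V)
  case (insert x V)
  then obtain w where w: "set w \<subseteq> V" "\<forall>i\<in>V. count_list w i = c i" by blast
  have rep: "count_list (replicate n x) i = (if i = x then n else 0)" for n i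
    by (induction n) auto
  have "count_list w x = 0" using w insert by (auto simp: count_list_0_iff)
  then show ?case
    using w insert by (intro exI[of _ "replicate (c x) x @ w"]) (auto simp: rep set_replicate_conv_if)
qed simp

text \<open>
  The representatives perform a walk as in the previous section. A chip at \<open>z\<close> does not change the
  class, which provides the idle step. Any \<open>\<rho>'\<close> is reached from any \<open>\<rho>\<close>: a large multiple of a
  strictly subharmonic function makes \<open>\<rho>' - \<rho>\<close>, up to firings, nonnegative off \<open>z\<close>.
\<close>

lemma rec_step_walk:
  assumes z: "z \<in> verts G" and \<alpha>: "set_pmf \<alpha> = verts G"
  shows "finite_bijection_walk (Rec G z) (verts G) (pmf \<alpha>) (rec_step z) z"
proof
  show "finite (Rec G z)" by (rule finite_Rec[OF z])
  show "Rec G z \<noteq> {}" using rec_rep(1)[OF z] by blast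
  show "0 < pmf \<alpha> i" if "i \<in> verts G" for i using that \<alpha> by (simp add: pmf_positive_iff)
  show "(\<Sum>i\<in>verts G. pmf \<alpha> i) = 1" using \<alpha> by (intro sum_pmf_eq_1) auto
  show "bij_betw (rec_step z i) (Rec G z) (Rec G z)" for i
  proof -
    have inj: "inj_on (rec_step z i) (Rec G z)"
    proof (rule inj_onI)
      fix \<rho> \<rho>' assume R: "\<rho> \<in> Rec G z" "\<rho>' \<in> Rec G z" and "rec_step z i \<rho> = rec_step z i \<rho>'"
      then have "equiv_off z (\<lambda>j. \<rho> j + \<delta> i j) (\<lambda>j. \<rho>' j + \<delta> i j)"
        by (simp add: rec_step_def rec_rep_eq_iff[OF z])
      from equiv_off_add[OF this, of "\<lambda>j. - \<delta> i j"] have "equiv_off z \<rho> \<rho>'" by simp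
      then show "\<rho> = \<rho>'" using Rec_equiv_off_unique[OF z R] by blast
    qed
    moreover have "rec_step z i ` Rec G z \<subseteq> Rec G z"
      using rec_rep(1)[OF z] by (auto simp: rec_step_def)
    ultimately show ?thesis
      using endo_inj_surj[OF finite_Rec[OF z]] by (simp add: bij_betw_def)
  qed
  show "rec_step z z \<rho> = \<rho>" if "\<rho> \<in> Rec G z" for \<rho>
    unfolding rec_step_def
    by (rule rec_rep_unique[OF z that])
       (auto simp: equiv_off_def \<delta>_def laplacian_const intro!: exI[of _ "\<lambda>_. 0"])
  show "\<exists>w. set w \<subseteq> verts G \<and> fold (rec_step z) w \<rho> = \<rho>'"
    if R: "\<rho> \<in> Rec G z" "\<rho>' \<in> Rec G z" for \<rho> \<rho>'
  proof -
    obtain v where v: "\<And>i. i \<in> verts G - {z} \<Longrightarrow> 1 \<le> laplacian G v i"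
      using exists_subharmonic_off[OF z] by blast
    define C where "C = max 0 (Max ((\<lambda>i. \<rho> i - \<rho>' i) ` verts G))"
    have C: "0 \<le> C" "\<And>i. i \<in> verts G \<Longrightarrow> \<rho> i - \<rho>' i \<le> C"
      by (auto simp: C_def le_max_iff_disj)
    define c where "c i = \<rho>' i - \<rho> i + laplacian G (\<lambda>j. C * v j) i" for i
    have c: "0 \<le> c i" if "i \<in> verts G - {z}" for i
      using C(2)[of i] mult_left_mono[OF v[OF that] C(1)] that
      by (simp add: c_def laplacian_scale)
    obtain w where w: "set w \<subseteq> verts G" "\<forall>i\<in>verts G. count_list w i = nat (c i)"
      using exists_word_with_counts[of "verts G" "\<lambda>i. nat (c i)"] by auto
    have "fold (rec_step z) w \<rho> = rec_rep z (\<lambda>j. \<rho> j + int (count_list w j))"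
      using fold_rec_step[OF z, of w \<rho>] rec_rep_Rec[OF z R(1)] by simp
    also have "\<dots> = \<rho>'"
    proof (rule rec_rep_unique[OF z R(2)])
      show "equiv_off z (\<lambda>j. \<rho> j + int (count_list w j)) \<rho>'"
        unfolding equiv_off_def using w c by (intro exI[of _ "\<lambda>j. C * v j"]) (auto simp: c_def)
    qed
    finally show ?thesis using w(1) by blast
  qed
qed (use z in simp_all)

text \<open>
  The chips are added as in the closed chain, but nothing is ever toppled. The two differ by
  firings only, which affect neither mass nor stabilizability.
\<close>

primrec driven :: "('a \<Rightarrow> int) \<Rightarrow> (nat \<Rightarrow> 'a) \<Rightarrow> nat \<Rightarrow> 'a \<Rightarrow> int" where
  "driven s is 0 = s"
| "driven s is (Suc k) = (\<lambda>j. driven s is k j + \<delta> (is (Suc k)) j)"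

lemma add_chip_equiv: "\<exists>u. \<forall>j. add_chip G i s j = s j + \<delta> i j + laplacian G u j"
proof -
  let ?s = "\<lambda>j. s j + \<delta> i j"
  show ?thesis
  proof (cases "stabilizable G ?s")
    case True
    then obtain "is" where "topplings G ?s is (stabilization G ?s)"
      using stabilization_stabilizes unfolding stabilizes_to_def by blast
    from topplings_result[OF this] show ?thesis
      using True by (intro exI[of _ "\<lambda>j. int (count_list is j)"]) (simp add: add_chip_def)
  next
    case False
    then show ?thesis by (intro exI[of _ "\<lambda>_. 0"]) (simp add: add_chip_def laplacian_const)
  qed
qed

lemma closed_chain_equiv:
  "\<exists>u. \<forall>j. closed_chain G s is k j = driven s is k j + laplacian G u j"
proof (induction k)
  case 0
  show ?case by (intro exI[of _ "\<lambda>_. 0"]) (simp add: laplacian_const)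
next
  case (Suc k)
  then obtain u where "\<forall>j. closed_chain G s is k j = driven s is k j + laplacian G u j" by blast
  moreover obtain w where "\<forall>j. closed_chain G s is (Suc k) j
      = closed_chain G s is k j + \<delta> (is (Suc k)) j + laplacian G w j"
    using add_chip_equiv by fastforce
  ultimately show ?case
    by (intro exI[of _ "\<lambda>j. u j + w j"]) (simp add: laplacian_add)
qed

lemma stabilizable_closed_chain:
  "stabilizable G (closed_chain G s is k) \<longleftrightarrow> stabilizable G (driven s is k)"
proof -
  obtain u where "closed_chain G s is k = (\<lambda>j. driven s is k j + laplacian G u j)"
    using closed_chain_equiv by blast
  then show ?thesis by (simp add: stabilizable_add_laplacian)
qed

lemma mass_closed_chain: "mass G (closed_chain G s is k) = mass G (driven s is k)"
proof -
  obtain u where "closed_chain G s is k = (\<lambda>j. driven s is k j + laplacian G u j)"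
    using closed_chain_equiv by blast
  then show ?thesis by (simp add: mass_add_laplacian)
qed

lemma mass_driven:
  assumes "\<And>l. 1 \<le> l \<Longrightarrow> is l \<in> verts G"
  shows "mass G (driven s is k) = mass G s + int k"
proof (induction k)
  case (Suc k)
  then show ?case using mass_delta[of "is (Suc k)" "driven s is k" 1] assms by simp
qed simp

text \<open>
  Stabilizability is lost for good, so the chain stops exactly at time \<open>Suc k\<close>, the only time with mass \<open>n\<close>,
  if stabilizability fails then but still holds at time \<open>k\<close>. The finiteness of \<open>Rec G z\<close> ensures
  that the threshold time exists.
\<close>

lemma mass_threshold_state_iff:
  assumes z: "z \<in> verts G" and V: "\<And>l. 1 \<le> l \<Longrightarrow> is l \<in> verts G"
    and n: "mass G s + int (Suc k) = int n"
  shows "mass G (threshold_state G s is) = int n \<longleftrightarrow>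
    mass G (rec_rep z (driven s is (Suc k))) \<le> int n \<and>
    \<not> mass G (rec_rep z (driven s is k)) \<le> int n - 1"
proof -
  let ?st = "\<lambda>k. stabilizable G (driven s is k)"
  have st_iff: "?st l \<longleftrightarrow> mass G s + int l < mass G (rec_rep z (driven s is l))" for l
    using stabilizable_iff_mass[OF z] mass_driven[of "is", OF V] by simp
  have mono: "?st l" if "?st m" "l \<le> m" for l m
    using that(2,1)
  proof (induction m rule: dec_induct)
    case (step m)
    then show ?case using stabilizable_antimono[of "driven s is (Suc m)"] by (auto simp: \<delta>_def)
  qed
  define B where "B = Max (mass G ` Rec G z)"
  have "mass G (rec_rep z t) \<le> B" for t
    unfolding B_def using finite_Rec[OF z] rec_rep(1)[OF z] by (intro Max_ge) auto
  then have "\<not> ?st (nat (B - mass G s))"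
    unfolding st_iff not_less by (rule order_trans) simp
  then have ex: "\<exists>l. \<not> ?st l" by blast
  define \<tau> where "\<tau> = threshold_time G s is"
  have \<tau>: "\<tau> = (LEAST l. \<not> ?st l)"
    by (simp add: \<tau>_def threshold_time_def stabilizable_closed_chain)
  have "mass G (threshold_state G s is) = mass G s + int \<tau>"
    by (simp add: threshold_state_def \<tau>_def mass_closed_chain mass_driven[of "is", OF V])
  then have "mass G (threshold_state G s is) = int n \<longleftrightarrow> \<tau> = Suc k" using n by auto
  also have "\<dots> \<longleftrightarrow> \<not> ?st (Suc k) \<and> ?st k"
  proof
    assume "\<tau> = Suc k"
    then show "\<not> ?st (Suc k) \<and> ?st k"
      using LeastI_ex[OF ex] not_less_Least[of k "\<lambda>l. \<not> ?st l"] \<tau> by auto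
  next
    assume *: "\<not> ?st (Suc k) \<and> ?st k"
    show "\<tau> = Suc k"
      unfolding \<tau>
    proof (rule Least_equality)
      fix l assume "\<not> ?st l"
      then have "\<not> l \<le> k" using * mono by blast
      then show "Suc k \<le> l" by simp
    qed (use * in blast)
  qed
  finally show ?thesis using n st_iff[of "Suc k"] st_iff[of k] by linarith
qed

end

section \<open>The law of the threshold mass\<close>

locale iid_driven_sandpile = eulerian_digraph G + prob_space M
  for G :: "('a, 'b) pre_digraph" and M :: "'w measure" +
  fixes \<alpha> :: "'a pmf" and I :: "nat \<Rightarrow> 'w \<Rightarrow> 'a"
  assumes set_pmf_\<alpha>: "set_pmf \<alpha> = verts G"
    and indep: "indep_vars (\<lambda>_. count_space UNIV) I {1..}"
    and law: "\<And>k. 1 \<le> k \<Longrightarrow> distr M (count_space UNIV) (I k) = measure_pmf \<alpha>"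
begin

lemma I_measurable: "1 \<le> k \<Longrightarrow> I k \<in> measurable M (count_space UNIV)"
  using indep by (auto simp: indep_vars_def)

lemma prob_I_eq: 
  assumes "1 \<le> k"
  shows "prob (I k -` {a} \<inter> space M) = pmf \<alpha> a"
  using measure_distr[OF I_measurable[OF assms], of "{a}"]
  by (simp add: law[OF assms] pmf.rep_eq)

lemma AE_I_in_verts: "AE \<omega> in M. \<forall>k\<ge>1. I k \<omega> \<in> verts G"
proof -
  have "AE \<omega> in M. I k \<omega> \<in> verts G" if k: "1 \<le> k" for k
  proof -
    have "AE a in distr M (count_space UNIV) (I k). a \<in> verts G"
      unfolding law[OF k] by (simp add: AE_measure_pmf_iff set_pmf_\<alpha>)
    then show ?thesis by (simp add: AE_distr_iff[OF I_measurable[OF k]])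
  qed
  then show ?thesis by (subst AE_all_countable) auto
qed

lemma prob_cylinder:
  "prob {\<omega>\<in>space M. \<forall>l\<in>{1..m}. I l \<omega> = a l} = (\<Prod>l=1..m. pmf \<alpha> (a l))"
proof (cases "m = 0")
  case False
  have "{\<omega>\<in>space M. \<forall>l\<in>{1..m}. I l \<omega> = a l} = (\<Inter>l\<in>{1..m}. I l -` {a l} \<inter> space M)"
    using False by auto
  also have "prob \<dots> = (\<Prod>l=1..m. prob (I l -` {a l} \<inter> space M))"
    using False by (intro indep_varsD[OF indep]) auto
  also have "\<dots> = (\<Prod>l=1..m. pmf \<alpha> (a l))"
    by (intro prod.cong refl prob_I_eq) auto
  finally show ?thesis .
qed (simp add: prob_space)

abbreviation position :: "('a \<Rightarrow> int) \<Rightarrow> nat \<Rightarrow> 'w \<Rightarrow> 'a \<Rightarrow> int" where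
  "position s k \<omega> \<equiv> driven s (\<lambda>l. I l \<omega>) k"

text \<open>
  The type \<open>'a\<close> need not be countable, so neither need be the range of the sandpile as a function
  on this type. Its restriction to the vertices takes values in a countable set, where measurability
  can be checked pointwise.
\<close>

lemma pred_position:
  assumes "\<And>s t. (\<And>i. i \<in> verts G \<Longrightarrow> s i = t i) \<Longrightarrow> A s = A t"
  shows "Measurable.pred M (\<lambda>\<omega>. A (position s k \<omega>))"
proof -
  let ?C = "PiE (verts G) (\<lambda>_. UNIV :: int set)"
  let ?X = "\<lambda>k \<omega>. restrict (position s k \<omega>) (verts G)"
  have "?X k \<in> measurable M (count_space ?C)"
  proof (induction k)
    case (Suc k)
    have step: "(\<lambda>\<omega>. restrict (\<lambda>j. x j + \<delta> (I (Suc k) \<omega>) j) (verts G)) \<in> measurable M (count_space ?C)"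
      if "x \<in> ?C" for x
      by (rule measurable_compose[OF I_measurable[of "Suc k"]]) auto
    have "(\<lambda>\<omega>. restrict (\<lambda>j. ?X k \<omega> j + \<delta> (I (Suc k) \<omega>) j) (verts G)) \<in> measurable M (count_space ?C)"
      by (rule measurable_compose_countable'[OF step Suc]) (auto intro: countable_PiE)
    also have "(\<lambda>\<omega>. restrict (\<lambda>j. ?X k \<omega> j + \<delta> (I (Suc k) \<omega>) j) (verts G)) = ?X (Suc k)"
      by (intro ext) (simp add: restrict_def)
    finally show ?case .
  next
    case 0
    show ?case by (simp only: driven.simps, rule measurable_const) (simp add: PiE_iff restrict_def extensional_def)
  qed
  then have "(\<lambda>\<omega>. A (?X k \<omega>)) \<in> measurable M (count_space UNIV)"
    by (rule measurable_compose) simp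
  also have "(\<lambda>\<omega>. A (?X k \<omega>)) = (\<lambda>\<omega>. A (position s k \<omega>))"
    by (intro ext assms) simp
  finally show ?thesis .
qed

abbreviation walk_op :: "(('a \<Rightarrow> int) \<Rightarrow> real) \<Rightarrow> ('a \<Rightarrow> int) \<Rightarrow> real" where
  "walk_op \<equiv> averaging (pmf \<alpha>) (verts G) (\<lambda>i s j. s j + \<delta> i j)"

lemma driven_cong: "(\<And>l. l \<in> {1..k} \<Longrightarrow> is l = js l) \<Longrightarrow> driven s is k = driven s js k"
  by (induction k) auto

text \<open>
  The Markov property in an elementary form: conditioning on the first \<open>m\<close> vertices \<open>a\<close>, the induction over
  \<open>k\<close> splits according to the next vertex. With a prefix of arbitrary length in the statement,
  only probabilities of cylinders are needed from the independence assumption.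
\<close>

lemma prob_cylinder_position:
  assumes A: "\<And>k. Measurable.pred M (\<lambda>\<omega>. A (position s k \<omega>))"
  shows "prob {\<omega>\<in>space M. (\<forall>l\<in>{1..m}. I l \<omega> = a l) \<and> A (position s (m + k) \<omega>)}
    = (\<Prod>l=1..m. pmf \<alpha> (a l)) * (walk_op ^^ k) (\<lambda>t. of_bool (A t)) (driven s a m)"
proof (induction k arbitrary: m a)
  case 0
  have "{\<omega>\<in>space M. (\<forall>l\<in>{1..m}. I l \<omega> = a l) \<and> A (position s (m + 0) \<omega>)}
      = (if A (driven s a m) then {\<omega>\<in>space M. \<forall>l\<in>{1..m}. I l \<omega> = a l} else {})"
    using driven_cong[of m "\<lambda>l. I l _" a s] by (auto; metis)
  then show ?case using prob_cylinder[of m a] by simp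
next
  case (Suc k)
  let ?f = "(walk_op ^^ k) (\<lambda>t. of_bool (A t))"
  let ?S = "\<lambda>m a k. {\<omega>\<in>space M. (\<forall>l\<in>{1..m}. I l \<omega> = a l) \<and> A (position s (m + k) \<omega>)}"
  let ?a = "\<lambda>b. a(Suc m := b)"
  have meas: "?S m a k \<in> events" for m a k
  proof -
    have [measurable]: "Measurable.pred M (\<lambda>\<omega>. I l \<omega> = a l)" if "l \<in> {1..m}" for l
      using that by (intro measurable_compose[OF I_measurable]) auto
    note A[measurable]
    show ?thesis by measurable
  qed
  have S: "?S (Suc m) (?a b) k = {\<omega>\<in>?S m a (Suc k). I (Suc m) \<omega> = b}" for b
    by (auto simp: atLeastAtMostSuc_conv)
  have "prob (?S m a (Suc k)) = prob (\<Union>b\<in>verts G. ?S (Suc m) (?a b) k)"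
  proof (rule measure_eq_AE)
    show "AE \<omega> in M. \<omega> \<in> ?S m a (Suc k) \<longleftrightarrow> \<omega> \<in> (\<Union>b\<in>verts G. ?S (Suc m) (?a b) k)"
      using AE_I_in_verts unfolding S by eventually_elim auto
    show "?S m a (Suc k) \<in> events" by (rule meas)
    show "(\<Union>b\<in>verts G. ?S (Suc m) (?a b) k) \<in> events"
      by (intro sets.finite_UN meas) simp
  qed
  also have "\<dots> = (\<Sum>b\<in>verts G. prob (?S (Suc m) (?a b) k))"
  proof (rule finite_measure_finite_Union)
    show "(\<lambda>b. ?S (Suc m) (?a b) k) ` verts G \<subseteq> events" using meas by (rule image_subsetI)
    show "disjoint_family_on (\<lambda>b. ?S (Suc m) (?a b) k) (verts G)"
      unfolding S disjoint_family_on_def by auto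
  qed simp
  also have "\<dots> = (\<Sum>b\<in>verts G. (\<Prod>l=1..m. pmf \<alpha> (a l)) * (pmf \<alpha> b * ?f (\<lambda>j. driven s a m j + \<delta> b j)))"
  proof (rule sum.cong[OF refl])
    fix b
    have "(\<Prod>l=1..Suc m. pmf \<alpha> (?a b l)) = (\<Prod>l=1..m. pmf \<alpha> (a l)) * pmf \<alpha> b"
      by (simp add: prod.nat_ivl_Suc')
    moreover have "driven s (?a b) (Suc m) = (\<lambda>j. driven s a m j + \<delta> b j)"
      using driven_cong[of m "?a b" a s] by simp
    ultimately show "prob (?S (Suc m) (?a b) k) =
        (\<Prod>l=1..m. pmf \<alpha> (a l)) * (pmf \<alpha> b * ?f (\<lambda>j. driven s a m j + \<delta> b j))"
      using Suc.IH[of "Suc m" "?a b"] by (simp only: mult.assoc)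
  qed
  also have "\<dots> = (\<Prod>l=1..m. pmf \<alpha> (a l)) * (walk_op ^^ Suc k) (\<lambda>t. of_bool (A t)) (driven s a m)"
    by (simp add: averaging_def flip: sum_distrib_left)
  finally show ?case .
qed

lemma prob_position:
  assumes "\<And>k. Measurable.pred M (\<lambda>\<omega>. A (position s k \<omega>))"
  shows "prob {\<omega>\<in>space M. A (position s k \<omega>)} = (walk_op ^^ k) (\<lambda>t. of_bool (A t)) s"
  using prob_cylinder_position[of A s 0 _ k, OF assms] by simp

lemma walk_op_rec_rep:
  assumes "z \<in> verts G"
  shows "(walk_op ^^ k) (\<lambda>t. h (rec_rep z t)) s
    = (averaging (pmf \<alpha>) (verts G) (rec_step z) ^^ k) h (rec_rep z s)"
proof (induction k arbitrary: s)
  case (Suc k)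
  then show ?case by (simp add: averaging_def rec_step_rec_rep[OF assms])
qed simp

lemma rec_rep_cong:
  assumes "\<And>i. i \<in> verts G \<Longrightarrow> s i = t i"
  shows "rec_rep z s = rec_rep z t"
  using assms by (simp add: rec_rep_def equiv_off_def)

lemma pred_mass_rec_rep: "Measurable.pred M (\<lambda>\<omega>. mass G (rec_rep z (position s k \<omega>)) \<le> c)"
  by (rule pred_position) (use rec_rep_cong in metis)

lemma prob_mass_rec_rep_tendsto:
  assumes z: "z \<in> verts G" and "0 < \<epsilon>"
  shows "\<exists>N. \<forall>k\<ge>N. \<forall>s. \<bar>prob {\<omega>\<in>space M. mass G (rec_rep z (position s k \<omega>)) \<le> c}
    - (\<Sum>\<rho>\<in>Rec G z. of_bool (mass G \<rho> \<le> c)) / card (Rec G z)\<bar> \<le> \<epsilon>"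
proof -
  interpret walk: finite_bijection_walk "Rec G z" "verts G" "pmf \<alpha>" "rec_step z" z
    by (rule rec_step_walk[OF z set_pmf_\<alpha>])
  let ?h = "\<lambda>\<rho>. of_bool (mass G \<rho> \<le> c) :: real"
  have "prob {\<omega>\<in>space M. mass G (rec_rep z (position s k \<omega>)) \<le> c} = (walk.T ^^ k) ?h (rec_rep z s)" for s k
    using prob_position[of "\<lambda>t. mass G (rec_rep z t) \<le> c" s k, OF pred_mass_rec_rep]
      walk_op_rec_rep[OF z, of k ?h s] by simp
  moreover obtain N where "\<And>k \<rho>. N \<le> k \<Longrightarrow> \<rho> \<in> Rec G z \<Longrightarrow>
      \<bar>(walk.T ^^ k) ?h \<rho> - (\<Sum>\<rho>\<in>Rec G z. ?h \<rho>) / card (Rec G z)\<bar> \<le> \<epsilon>"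
    using walk.averaging_pow_tendsto_mean[OF \<open>0 < \<epsilon>\<close>, of ?h] by blast
  ultimately show ?thesis using rec_rep(1)[OF z] by (intro exI[of _ N]) simp
qed

text \<open>
  Measurability has to be shown for the event itself, also where some \<open>I k\<close> is not a vertex,
  since \<open>M\<close> need not be complete.
\<close>

lemma threshold_event: "{\<omega>\<in>space M. mass G (threshold_state G s (\<lambda>l. I l \<omega>)) = n} \<in> events"
proof -
  have [measurable]: "Measurable.pred M (\<lambda>\<omega>. \<not> stabilizable G (position s k \<omega>))" for k
    by (rule pred_position) (use stabilizable_cong in metis)
  have Q: "Measurable.pred M (\<lambda>\<omega>. mass G (position s k \<omega>) = n)" for k
    by (rule pred_position) (simp add: mass_def)
  have "(\<lambda>\<omega>. LEAST k. \<not> stabilizable G (position s k \<omega>)) \<in> measurable M (count_space UNIV)"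
    by measurable
  from measurable_compose_countable[OF Q this] show ?thesis
    by (simp add: threshold_state_def threshold_time_def mass_closed_chain stabilizable_closed_chain pred_def)
qed

text \<open>
  The second event is almost surely contained in the first, because stabilizability is lost for
  good; so the probability of the difference is the difference of the probabilities.
\<close>

lemma prob_threshold:
  assumes z: "z \<in> verts G" and n: "mass G s + int (Suc k) = int n"
  shows "prob {\<omega>\<in>space M. mass G (threshold_state G s (\<lambda>l. I l \<omega>)) = int n}
    = prob {\<omega>\<in>space M. mass G (rec_rep z (position s (Suc k) \<omega>)) \<le> int n}
    - prob {\<omega>\<in>space M. mass G (rec_rep z (position s k \<omega>)) \<le> int n - 1}" (is "_ = prob ?A - prob ?B")
proof -
  have meas: "?A \<in> events" "?B \<in> events"
    using pred_mass_rec_rep by (simp_all only: pred_def)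
  have le: "AE \<omega> in M. \<omega> \<in> ?B \<longrightarrow> \<omega> \<in> ?A"
    using AE_I_in_verts
  proof eventually_elim
    case (elim \<omega>)
    have md: "mass G (position s l \<omega>) = mass G s + int l" for l
      using mass_driven[of "\<lambda>l. I l \<omega>"] elim by blast
    have "stabilizable G (position s (Suc k) \<omega>) \<Longrightarrow> stabilizable G (position s k \<omega>)"
      by (erule stabilizable_antimono) (simp add: \<delta>_def)
    then have "mass G (rec_rep z (position s k \<omega>)) \<le> mass G s + int k \<Longrightarrow>
        mass G (rec_rep z (position s (Suc k) \<omega>)) \<le> mass G s + int (Suc k)"
      unfolding stabilizable_iff_mass[OF z] md by linarith
    then show ?case using n by (simp del: driven.simps)
  qed
  have "prob {\<omega>\<in>space M. mass G (threshold_state G s (\<lambda>l. I l \<omega>)) = int n} = prob (?A - ?B)"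
  proof (rule measure_eq_AE)
    show "AE \<omega> in M. \<omega> \<in> {\<omega>\<in>space M. mass G (threshold_state G s (\<lambda>l. I l \<omega>)) = int n} \<longleftrightarrow> \<omega> \<in> ?A - ?B"
      using AE_I_in_verts
    proof eventually_elim
      case (elim \<omega>)
      then show ?case using mass_threshold_state_iff[OF z _ n, of "\<lambda>l. I l \<omega>"] by auto
    qed
  qed (use meas threshold_event in auto)
  also have "\<dots> = prob ?A - prob (?A \<inter> ?B)"
    using finite_measure_Diff'[OF meas] by simp
  also have "prob (?A \<inter> ?B) = prob ?B"
    using le meas by (intro measure_eq_AE) auto
  finally show ?thesis .
qed

theorem prob_threshold_mass_tendsto:
  assumes z: "z \<in> verts G" and \<epsilon>: "0 < \<epsilon>"
  shows "\<exists>K<0. \<forall>s. mass G s < K \<longrightarrow>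
    \<bar>prob {\<omega>\<in>space M. mass G (threshold_state G s (\<lambda>l. I l \<omega>)) = int n}
      - (\<Sum>\<rho>\<in>Rec G z. of_bool (mass G \<rho> = int n)) / card (Rec G z)\<bar> \<le> \<epsilon>"
proof -
  let ?P = "\<lambda>c k s. prob {\<omega>\<in>space M. mass G (rec_rep z (position s k \<omega>)) \<le> c}"
  let ?L = "\<lambda>c. (\<Sum>\<rho>\<in>Rec G z. of_bool (mass G \<rho> \<le> c)) / real (card (Rec G z))"
  obtain N1 where N1: "\<And>k s. N1 \<le> k \<Longrightarrow> \<bar>?P (int n) k s - ?L (int n)\<bar> \<le> \<epsilon> / 2"
    using prob_mass_rec_rep_tendsto[OF z, of "\<epsilon> / 2" "int n"] \<epsilon> by auto
  obtain N2 where N2: "\<And>k s. N2 \<le> k \<Longrightarrow> \<bar>?P (int n - 1) k s - ?L (int n - 1)\<bar> \<le> \<epsilon> / 2"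
    using prob_mass_rec_rep_tendsto[OF z, of "\<epsilon> / 2" "int n - 1"] \<epsilon> by auto
  have "(\<Sum>\<rho>\<in>Rec G z. of_bool (mass G \<rho> = int n) :: real)
      = (\<Sum>\<rho>\<in>Rec G z. of_bool (mass G \<rho> \<le> int n) - of_bool (mass G \<rho> \<le> int n - 1))"
    by (intro sum.cong) auto
  then have L: "(\<Sum>\<rho>\<in>Rec G z. of_bool (mass G \<rho> = int n)) / card (Rec G z) = ?L (int n) - ?L (int n - 1)"
    by (simp add: sum_subtractf diff_divide_distrib)
  show ?thesis
  proof (intro exI[of _ "- int (N1 + N2 + 1)"] conjI allI impI)
    fix s assume s: "mass G s < - int (N1 + N2 + 1)"
    define k where "k = nat (int n - mass G s - 1)"
    have k: "mass G s + int (Suc k) = int n" "N1 \<le> Suc k" "N2 \<le> k"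
      using s by (auto simp: k_def)
    show "\<bar>prob {\<omega>\<in>space M. mass G (threshold_state G s (\<lambda>l. I l \<omega>)) = int n}
      - (\<Sum>\<rho>\<in>Rec G z. of_bool (mass G \<rho> = int n)) / card (Rec G z)\<bar> \<le> \<epsilon>"
      unfolding L prob_threshold[OF z k(1)] using N1[OF k(2), of s] N2[OF k(3), of s] by linarith
  qed simp
qed

end

theorem corollary5:
  fixes G :: "('a, 'b) pre_digraph"
    and \<alpha> :: "'a pmf"
    and M :: "'w measure"
    and I :: "nat \<Rightarrow> 'w \<Rightarrow> 'a"
    and n :: nat
    and z :: 'a
  assumes "fin_digraph G"
    and "Digraph_Component.connected G"
    and "eulerian G"
    and "set_pmf \<alpha> = verts G"
    and "prob_space M"
    and "prob_space.indep_vars M (\<lambda>_. count_space UNIV) I {1..}"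
    and "\<And>k. k \<ge> 1 \<Longrightarrow> distr M (count_space UNIV) (I k) = measure_pmf \<alpha>"
    and "z \<in> verts G"
  shows "\<forall>\<epsilon>>0. \<exists>K<0. \<forall>s\<^sub>0 \<in> sandpiles G. mass G s\<^sub>0 < K \<longrightarrow>
    \<bar>measure M {\<omega> \<in> space M. mass G (threshold_state G s\<^sub>0 (\<lambda>k. I k \<omega>)) = int n}
      - 1 / real (card (Rec G z)) * (\<Sum>\<rho> \<in> Rec G z. of_bool (mass G \<rho> = int n))\<bar> \<le> \<epsilon>"
proof -
  interpret iid_driven_sandpile G M \<alpha> I
    using assms by (intro iid_driven_sandpile.intro iid_driven_sandpile_axioms.intro
        eulerian_digraph.intro eulerian_digraph_axioms.intro)
  show ?thesis
    using prob_threshold_mass_tendsto[OF assms(8), of _ n] by fastforce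
qed

end
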